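(* Let $p$ be a prime, $1<r<\infty$, $\alpha>0$, and let $\tau\in\mathbb{Q}_p$ with $\tau\neq0$. For a function $f$ on $\mathbb{Q}_p$ let $(\mathcal{D}_\tau f)(x)=f(\tau x)$, $x\in\mathbb{Q}_p$. Then, for all $f\in\mathfrak{B}_{r,\alpha}(\mathbb{Q}_p)$, $$\|\mathcal{D}_\tau f\|_{\mathfrak{B}_{r,\alpha}(\mathbb{Q}_p)}\le 2\,|\tau|_p^{-(1/r+\alpha)}\,\|f\|_{\mathfrak{B}_{r,\alpha}(\mathbb{Q}_p)}.$$
   Context: $\mathbb{Q}_p$ is the field of $p$-adic numbers with absolute value $|\cdot|_p$. $dx$ is the Haar measure on the additive group $\mathbb{Q}_p$ normalized so that $\{|x|_p\le1\}$ has measure $1$, and $|E|$ denotes the Haar measure of $E$. For $n\in\mathbb{Z}$, $B^n=\{x\in\mathbb{Q}_p:|x|_p\le p^n\}$, so $|B^n|=p^n$. A function $a:\mathbb{Q}_p\to\mathbb{C}$ is a central $(r,\alpha)$-block if there exists $n\in\mathbb{Z}$ such that $\operatorname{supp}a\subset B^n$ and $\|a\|_{L^r(\mathbb{Q}_p)}\le|B^n|^{-\alpha}$. The block space $\mathfrak{B}_{r,\alpha}(\mathbb{Q}_p)$ is the set of all $f\in L^r_{\mathrm{loc}}(\mathbb{Q}_p)$ that can be written as $f=\sum_{k=1}^\infty\lambda_ka_k$ (almost everywhere) with scalars $\lambda_k$ satisfying $\sum_k|\lambda_k|<\infty$ and each $a_k$ a central $(r,\alpha)$-block; its norm is $\|f\|_{\mathfrak{B}_{r,\alpha}(\mathbb{Q}_p)}=\inf\sum_{k=1}^\infty|\lambda_k|$,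 the infimum being over all such decompositions of $f$. *)

theory Defs
  imports "HOL-Analysis.Analysis" "HOL-Computational_Algebra.Primes"
begin

section \<open>The field of p-adic numbers\<close>

subsection \<open>The p-adic absolute value on the rationals\<close>

definition pabs :: "nat \<Rightarrow> rat \<Rightarrow> real" where
  "pabs p x = (if x = 0 then 0
     else real p powi (int (multiplicity (int p) (snd (quotient_of x)))
                     - int (multiplicity (int p) (fst (quotient_of x)))))"

lemma pabs_0 [simp]: "pabs p 0 = 0"
  by (simp add: pabs_def)

lemma pabs_divide:
  assumes p: "prime p" and "a \<noteq> 0" "b \<noteq> 0"
  shows "pabs p (of_int a / of_int b) =
    real p powi (int (multiplicity (int p) b) - int (multiplicity (int p) a))"
proof -
  let ?m = "multiplicity (int p)"
  obtain c d where cd: "quotient_of (of_int a / of_int b) = (c, d)"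
    by (cases "quotient_of (of_int a / of_int b)")
  have d: "d > 0" using quotient_of_denom_pos[OF cd] .
  have "of_int a / of_int b = (of_int c / of_int d :: rat)"
    using quotient_of_div[OF cd] .
  then have eq: "a * d = c * b"
    using assms d by (simp add: field_simps flip: of_int_mult)
  with assms d have "c \<noteq> 0" by auto
  have "prime_elem (int p)" using p by auto
  then have "?m a + ?m d = ?m c + ?m b"
    using arg_cong[OF eq, of ?m] assms d \<open>c \<noteq> 0\<close>
    by (simp add: prime_elem_multiplicity_mult_distrib)
  then have "int (?m d) - int (?m c) = int (?m b) - int (?m a)" by linarith
  then show ?thesis using assms cd by (simp add: pabs_def)
qed

lemma rat_fraction: obtains a b where "x = (of_int a / of_int b :: rat)" "b \<noteq> 0"
  by (metis Rat_cases Fract_of_int_quotient less_irrefl)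

lemma pabs_nonneg [simp]: "pabs p x \<ge> 0"
  by (simp add: pabs_def)

lemma pabs_eq_0 [simp]: "prime p \<Longrightarrow> pabs p x = 0 \<longleftrightarrow> x = 0"
  by (auto simp: pabs_def prime_gt_0_nat)

lemma pabs_1 [simp]: "pabs p 1 = 1"
  by (simp add: pabs_def)

lemma pabs_mult:
  assumes p: "prime p"
  shows "pabs p (x * y) = pabs p x * pabs p y"
proof (cases "x = 0 \<or> y = 0")
  case False
  obtain a b where x: "x = of_int a / of_int b" "b \<noteq> 0" by (rule rat_fraction)
  obtain c d where y: "y = of_int c / of_int d" "d \<noteq> 0" by (rule rat_fraction)
  have nz: "a \<noteq> 0" "c \<noteq> 0" using False x y by auto
  have [simp]: "prime_elem (int p)" "p \<noteq> 0" using p by auto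
  have xy: "x * y = of_int (a * c) / of_int (b * d)" by (simp add: x y)
  have "pabs p (x * y) = real p powi (int (multiplicity (int p) (b * d)) - int (multiplicity (int p) (a * c)))"
    unfolding xy by (rule pabs_divide) (use p nz x y in auto)
  also have "\<dots> = pabs p x * pabs p y"
    using p nz x(2) y(2)
    by (simp add: x(1) y(1) pabs_divide prime_elem_multiplicity_mult_distrib flip: power_int_add)
       (simp add: algebra_simps)
  finally show ?thesis .
qed auto

lemma pabs_minus [simp]: "pabs p (- x) = pabs p x"
proof -
  have "multiplicity a (- b) = multiplicity a b" for a b :: int
    by (rule multiplicity_cong) simp
  then show ?thesis
    by (auto simp: pabs_def rat_uminus_code split: prod.splits)
qed

lemma pabs_minus_commute: "pabs p (x - y) = pabs p (y - x)"
  by (metis minus_diff_eq pabs_minus)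

lemma pabs_inverse: "prime p \<Longrightarrow> pabs p (inverse x) = inverse (pabs p x)"
proof (cases "x = 0")
  case False
  assume p: "prime p"
  have "pabs p x * pabs p (inverse x) = 1"
    using False by (simp flip: pabs_mult[OF p])
  then show ?thesis by (metis inverse_unique)
qed auto

lemma pabs_ultrametric:
  assumes p: "prime p"
  shows "pabs p (x + y) \<le> max (pabs p x) (pabs p y)"
proof (cases "x = 0 \<or> y = 0 \<or> x + y = 0")
  case False
  let ?m = "multiplicity (int p)"
  obtain a b where x: "x = of_int a / of_int b" "b \<noteq> 0" by (rule rat_fraction)
  obtain c d where y: "y = of_int c / of_int d" "d \<noteq> 0" by (rule rat_fraction)
  have x': "x = of_int (a * d) / of_int (b * d)" and y': "y = of_int (c * b) / of_int (b * d)"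
    using x y by auto
  have xy: "x + y = of_int (a * d + c * b) / of_int (b * d)"
    by (simp add: x' y' add_divide_distrib)
  have nz: "a * d \<noteq> 0" "c * b \<noteq> 0" "b * d \<noteq> 0" using False x y by auto
  have nz': "a * d + c * b \<noteq> 0" using False xy by (metis of_int_0 div_0)
  have p1: "real p > 1" using prime_gt_1_nat[OF p] by simp
  have "int p ^ min (?m (a * d)) (?m (c * b)) dvd a * d + c * b"
    by (intro dvd_add) (simp_all add: multiplicity_dvd')
  then have "min (?m (a * d)) (?m (c * b)) \<le> ?m (a * d + c * b)"
    using nz' prime_gt_1_nat[OF p] by (intro multiplicity_geI) auto
  then have "?m (a * d) \<le> ?m (a * d + c * b) \<or> ?m (c * b) \<le> ?m (a * d + c * b)"
    by linarith
  then show ?thesis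
  proof
    assume "?m (a * d) \<le> ?m (a * d + c * b)"
    then have "pabs p (x + y) \<le> pabs p x"
      unfolding xy unfolding x' using p nz nz' p1
      by (subst (1 2) pabs_divide) (auto intro!: power_int_increasing)
    then show ?thesis by simp
  next
    assume "?m (c * b) \<le> ?m (a * d + c * b)"
    then have "pabs p (x + y) \<le> pabs p y"
      unfolding xy unfolding y' using p nz nz' p1
      by (subst (1 2) pabs_divide) (auto intro!: power_int_increasing)
    then show ?thesis by simp
  qed
qed (auto simp: le_max_iff_disj)

lemma pabs_triangle: "prime p \<Longrightarrow> pabs p (x + y) \<le> pabs p x + pabs p y"
  using pabs_ultrametric[of p x y] pabs_nonneg[of p x] pabs_nonneg[of p y] by linarith

lemma pabs_diff_ineq:
  assumes p: "prime p"
  shows "\<bar>pabs p x - pabs p y\<bar> \<le> pabs p (x - y)"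
  using pabs_triangle[OF p, of "x - y" y] pabs_triangle[OF p, of "y - x" x]
    pabs_minus_commute[of p x y] by simp


subsection \<open>Cauchy sequences and null sequences\<close>

definition pnull :: "nat \<Rightarrow> (nat \<Rightarrow> rat) \<Rightarrow> bool" where
  "pnull p X \<longleftrightarrow> (\<lambda>n. pabs p (X n)) \<longlonglongrightarrow> 0"

definition pcauchy :: "nat \<Rightarrow> (nat \<Rightarrow> rat) \<Rightarrow> bool" where
  "pcauchy p X \<longleftrightarrow> (\<forall>e>0. \<exists>N. \<forall>m\<ge>N. \<forall>n\<ge>N. pabs p (X m - X n) < e)"

definition padic_rel :: "nat \<Rightarrow> (nat \<Rightarrow> rat) \<Rightarrow> (nat \<Rightarrow> rat) \<Rightarrow> bool" where
  "padic_rel p X Y \<longleftrightarrow> pcauchy p X \<and> pcauchy p Y \<and> pnull p (\<lambda>n. X n - Y n)"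

lemma pnull_bound:
  assumes "eventually (\<lambda>n. pabs p (X n) \<le> f n) sequentially" "f \<longlonglongrightarrow> 0"
  shows "pnull p X"
  unfolding pnull_def
  by (rule tendsto_sandwich[OF _ assms(1) tendsto_const assms(2)]) simp

lemma pnull_minus: "pnull p X \<Longrightarrow> pnull p (\<lambda>n. - X n)"
  by (simp add: pnull_def)

lemma pnull_add:
  assumes p: "prime p" and "pnull p X" "pnull p Y"
  shows "pnull p (\<lambda>n. X n + Y n)"
proof (rule pnull_bound)
  show "eventually (\<lambda>n. pabs p (X n + Y n) \<le> pabs p (X n) + pabs p (Y n)) sequentially"
    by (simp add: pabs_triangle[OF p])
  show "(\<lambda>n. pabs p (X n) + pabs p (Y n)) \<longlonglongrightarrow> 0"
    using tendsto_add[OF assms(2,3)[unfolded pnull_def]] by simp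
qed

lemma pcauchy_const [simp]: "pcauchy p (\<lambda>n. x)"
  by (simp add: pcauchy_def)

lemma pcauchy_minus: "pcauchy p X \<Longrightarrow> pcauchy p (\<lambda>n. - X n)"
  unfolding pcauchy_def by (simp add: pabs_minus_commute)

lemma pcauchy_add:
  assumes p: "prime p" and X: "pcauchy p X" and Y: "pcauchy p Y"
  shows "pcauchy p (\<lambda>n. X n + Y n)"
  unfolding pcauchy_def
proof (intro allI impI)
  fix e :: real assume "e > 0"
  obtain M where M: "\<forall>m\<ge>M. \<forall>n\<ge>M. pabs p (X m - X n) < e" 
    using X \<open>e > 0\<close> unfolding pcauchy_def by blast
  obtain N where N: "\<forall>m\<ge>N. \<forall>n\<ge>N. pabs p (Y m - Y n) < e" 
    using Y \<open>e > 0\<close> unfolding pcauchy_def by blast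
  show "\<exists>N. \<forall>m\<ge>N. \<forall>n\<ge>N. pabs p (X m + Y m - (X n + Y n)) < e"
  proof (rule exI[of _ "max M N"], intro allI impI)
    fix m n assume "m \<ge> max M N" "n \<ge> max M N"
    then have "max (pabs p (X m - X n)) (pabs p (Y m - Y n)) < e" using M N by auto
    then show "pabs p (X m + Y m - (X n + Y n)) < e"
      using pabs_ultrametric[OF p, of "X m - X n" "Y m - Y n"] unfolding add_diff_add by linarith
  qed
qed

lemma pcauchy_pabs_convergent:
  assumes p: "prime p" and X: "pcauchy p X"
  shows "convergent (\<lambda>n. pabs p (X n))"
proof (rule Cauchy_convergent, rule CauchyI)
  fix e :: real assume "e > 0"
  then obtain N where "\<forall>m\<ge>N. \<forall>n\<ge>N. pabs p (X m - X n) < e" 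
    using X unfolding pcauchy_def by blast
  then show "\<exists>N. \<forall>m\<ge>N. \<forall>n\<ge>N. norm (pabs p (X m) - pabs p (X n)) < e"
    by (metis pabs_diff_ineq[OF p] order_le_less_trans real_norm_def)
qed

lemma pcauchy_bounded:
  assumes p: "prime p" and X: "pcauchy p X"
  obtains b where "b > 0" "\<And>n. pabs p (X n) \<le> b"
  using convergent_imp_Bseq[OF pcauchy_pabs_convergent[OF assms]]
  unfolding Bseq_def by auto

lemma pnull_mult_bounded:
  assumes p: "prime p" and X: "pcauchy p X" and Y: "pnull p Y"
  shows "pnull p (\<lambda>n. X n * Y n)"
proof -
  obtain b where b: "b > 0" "\<And>n. pabs p (X n) \<le> b" using pcauchy_bounded[OF p X] by blast
  show ?thesis
  proof (rule pnull_bound)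
    show "eventually (\<lambda>n. pabs p (X n * Y n) \<le> b * pabs p (Y n)) sequentially"
      by (simp add: pabs_mult[OF p] b mult_right_mono)
    show "(\<lambda>n. b * pabs p (Y n)) \<longlonglongrightarrow> 0"
      using tendsto_mult_left[OF Y[unfolded pnull_def], of b] by simp
  qed
qed

lemma pcauchy_mult:
  assumes p: "prime p" and X: "pcauchy p X" and Y: "pcauchy p Y"
  shows "pcauchy p (\<lambda>n. X n * Y n)"
  unfolding pcauchy_def
proof (intro allI impI)
  fix e :: real assume "e > 0"
  obtain a where a: "a > 0" "\<And>n. pabs p (X n) \<le> a" using pcauchy_bounded[OF p X] by blast
  obtain b where b: "b > 0" "\<And>n. pabs p (Y n) \<le> b" using pcauchy_bounded[OF p Y] by blast
  have "e / b > 0" "e / a > 0" using a b \<open>e > 0\<close> by auto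
  obtain M where M: "\<forall>m\<ge>M. \<forall>n\<ge>M. pabs p (X m - X n) < e / b" 
    using X \<open>e / b > 0\<close> unfolding pcauchy_def by blast
  obtain N where N: "\<forall>m\<ge>N. \<forall>n\<ge>N. pabs p (Y m - Y n) < e / a" 
    using Y \<open>e / a > 0\<close> unfolding pcauchy_def by blast
  show "\<exists>N. \<forall>m\<ge>N. \<forall>n\<ge>N. pabs p (X m * Y m - X n * Y n) < e"
  proof (rule exI[of _ "max M N"], intro allI impI)
    fix m n assume mn: "m \<ge> max M N" "n \<ge> max M N"
    have "pabs p (X m * (Y m - Y n)) \<le> a * pabs p (Y m - Y n)"
      by (simp add: pabs_mult[OF p] a mult_right_mono)
    also have "\<dots> < a * (e / a)"
      using N mn a by (intro mult_strict_left_mono) auto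
    finally have 1: "pabs p (X m * (Y m - Y n)) < e" using a by simp
    have "pabs p ((X m - X n) * Y n) \<le> pabs p (X m - X n) * b"
      by (simp add: pabs_mult[OF p] b mult_left_mono)
    also have "\<dots> < (e / b) * b"
      using M mn b by (intro mult_strict_right_mono) auto
    finally have 2: "pabs p ((X m - X n) * Y n) < e" using b by simp
    show "pabs p (X m * Y m - X n * Y n) < e"
      using 1 2 pabs_ultrametric[OF p, of "X m * (Y m - Y n)" "(X m - X n) * Y n"]
      unfolding mult_diff_mult by linarith
  qed
qed

lemma pcauchy_not_pnull:
  assumes p: "prime p" and X: "pcauchy p X" and nz: "\<not> pnull p X"
  obtains b N where "b > 0" "\<And>n. n \<ge> N \<Longrightarrow> pabs p (X n) > b"
proof -
  obtain L where L: "(\<lambda>n. pabs p (X n)) \<longlonglongrightarrow> L"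
    using pcauchy_pabs_convergent[OF p X] by (auto simp: convergent_def)
  have "L \<ge> 0" using L by (rule LIMSEQ_le_const) auto
  moreover have "L \<noteq> 0" using L nz by (auto simp: pnull_def)
  ultimately have "L > 0" by simp
  then have "eventually (\<lambda>n. pabs p (X n) > L / 2) sequentially"
    by (intro order_tendstoD(1)[OF L]) simp
  then show ?thesis using that[of "L / 2"] \<open>L > 0\<close> by (auto simp: eventually_sequentially)
qed

lemma pcauchy_inverse:
  assumes p: "prime p" and X: "pcauchy p X" and nz: "\<not> pnull p X"
  shows "pcauchy p (\<lambda>n. inverse (X n))"
  unfolding pcauchy_def
proof (intro allI impI)
  fix e :: real assume "e > 0"
  obtain b M where b: "b > 0" "\<And>n. n \<ge> M \<Longrightarrow> pabs p (X n) > b"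
    using pcauchy_not_pnull[OF assms] by blast
  have "b * e * b > 0" using b \<open>e > 0\<close> by simp
  then obtain N where N: "\<forall>m\<ge>N. \<forall>n\<ge>N. pabs p (X m - X n) < b * e * b" 
    using X unfolding pcauchy_def by blast
  show "\<exists>N. \<forall>m\<ge>N. \<forall>n\<ge>N. pabs p (inverse (X m) - inverse (X n)) < e"
  proof (rule exI[of _ "max M N"], intro allI impI)
    fix m n assume mn: "m \<ge> max M N" "n \<ge> max M N"
    then have Xb: "pabs p (X m) > b" "pabs p (X n) > b" using b by auto
    then have "X m \<noteq> 0" "X n \<noteq> 0" using b by auto
    then have "pabs p (inverse (X m) - inverse (X n))
        = inverse (pabs p (X m)) * pabs p (X m - X n) * inverse (pabs p (X n))"
      by (simp add: inverse_diff_inverse pabs_mult[OF p] pabs_inverse[OF p])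
    also have "\<dots> < inverse b * (b * e * b) * inverse b"
      using Xb b mn N by (intro mult_strict_mono' less_imp_inverse_less) auto
    also have "\<dots> = e" using b by simp
    finally show "pabs p (inverse (X m) - inverse (X n)) < e" .
  qed
qed

lemma pnull_diff_inverse:
  assumes p: "prime p" and X: "pcauchy p X" "\<not> pnull p X" and Y: "pcauchy p Y" "\<not> pnull p Y"
    and XY: "pnull p (\<lambda>n. X n - Y n)"
  shows "pnull p (\<lambda>n. inverse (X n) - inverse (Y n))"
proof -
  obtain a M where a: "a > 0" "\<And>n. n \<ge> M \<Longrightarrow> pabs p (X n) > a"
    using pcauchy_not_pnull[OF p X] by blast
  obtain b N where b: "b > 0" "\<And>n. n \<ge> N \<Longrightarrow> pabs p (Y n) > b"
    using pcauchy_not_pnull[OF p Y] by blast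
  have "pnull p (\<lambda>n. (inverse (X n) * inverse (Y n)) * (X n - Y n))"
    by (intro pnull_mult_bounded pcauchy_mult pcauchy_inverse assms)
  then have "pnull p (\<lambda>n. - ((inverse (X n) * inverse (Y n)) * (X n - Y n)))"
    by (rule pnull_minus)
  moreover have "eventually (\<lambda>n. pabs p (- ((inverse (X n) * inverse (Y n)) * (X n - Y n)))
      = pabs p (inverse (X n) - inverse (Y n))) sequentially"
    using eventually_ge_at_top[of "max M N"]
  proof eventually_elim
    case (elim n)
    then have "X n \<noteq> 0" "Y n \<noteq> 0" using a(2)[of n] b(2)[of n] a(1) b(1) by auto
    then show ?case by (simp add: inverse_diff_inverse mult_ac)
  qed
  ultimately show ?thesis
    unfolding pnull_def by (auto intro: Lim_transform_eventually)
qed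

lemma part_equivp_padic_rel:
  assumes p: "prime p"
  shows "part_equivp (padic_rel p)"
proof (rule part_equivpI)
  show "\<exists>X. padic_rel p X X"
    by (rule exI[of _ "\<lambda>_. 0"]) (simp add: padic_rel_def pnull_def)
  show "symp (padic_rel p)"
    by (auto simp: symp_def padic_rel_def pnull_def pabs_minus_commute)
  show "transp (padic_rel p)"
  proof (rule transpI)
    fix X Y Z assume "padic_rel p X Y" "padic_rel p Y Z"
    then show "padic_rel p X Z"
      using pnull_add[OF p, of "\<lambda>n. X n - Y n" "\<lambda>n. Y n - Z n"]
      by (simp add: padic_rel_def)
  qed
qed

subsection \<open>The completion\<close>

text \<open>The prime p enters as the cardinality of the index type: a theorem about
  \<open>'p::prime_card padic\<close> is a theorem about the p-adic numbers for p = \<open>CARD('p)\<close>,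
  and every prime is the cardinality of some type.\<close>

class prime_card = finite +
  assumes prime_card: "prime CARD('a)"

lemma prime_card_eq [simp]: "prime CARD('p::prime_card)"
  by (rule prime_card)

typedef ('p::prime_card) padic =
  "{C. \<exists>X. pcauchy CARD('p) X \<and> C = Collect (padic_rel CARD('p) X)}"
  by (auto intro: pcauchy_const)

definition padic_of_seq :: "(nat \<Rightarrow> rat) \<Rightarrow> 'p::prime_card padic" where
  "padic_of_seq X = Abs_padic (Collect (padic_rel CARD('p) X))"

definition seq_of_padic :: "'p::prime_card padic \<Rightarrow> nat \<Rightarrow> rat" where
  "seq_of_padic x = (SOME X. X \<in> Rep_padic x)"

lemma padic_rel_refl: "pcauchy p X \<Longrightarrow> padic_rel p X X"
  by (simp add: padic_rel_def pnull_def)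

lemma padic_rel_sym: "padic_rel p X Y \<Longrightarrow> padic_rel p Y X"
  by (simp add: padic_rel_def pnull_def pabs_minus_commute)

lemma padic_rel_trans:
  "prime p \<Longrightarrow> padic_rel p X Y \<Longrightarrow> padic_rel p Y Z \<Longrightarrow> padic_rel p X Z"
  using part_equivp_padic_rel by (metis part_equivp_def)

lemma padic_of_seq_eq_iff:
  assumes "pcauchy CARD('p) X" "pcauchy CARD('p) Y"
  shows "padic_of_seq X = (padic_of_seq Y :: 'p::prime_card padic) \<longleftrightarrow> pnull CARD('p) (\<lambda>n. X n - Y n)"
proof -
  let ?R = "padic_rel CARD('p)"
  have "padic_of_seq X = (padic_of_seq Y :: 'p padic) \<longleftrightarrow> Collect (?R X) = Collect (?R Y)"
    unfolding padic_of_seq_def using assms by (subst Abs_padic_inject) auto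
  also have "\<dots> \<longleftrightarrow> ?R X Y"
    using assms by (auto intro: padic_rel_refl padic_rel_sym padic_rel_trans[OF prime_card])
  finally show ?thesis using assms by (simp add: padic_rel_def)
qed

lemma seq_of_padic:
  fixes x :: "'p::prime_card padic"
  shows pcauchy_seq_of_padic [simp]: "pcauchy CARD('p) (seq_of_padic x)"
    and padic_of_seq_of_padic [simp]: "padic_of_seq (seq_of_padic x) = x"
proof -
  obtain X where X: "pcauchy CARD('p) X" "Rep_padic x = Collect (padic_rel CARD('p) X)"
    using Rep_padic[of x] by auto
  then have "X \<in> Rep_padic x" by (simp add: padic_rel_refl)
  then have "seq_of_padic x \<in> Rep_padic x" unfolding seq_of_padic_def
    by (rule someI[where P = "\<lambda>X. X \<in> Rep_padic x"])
  then have rel: "padic_rel CARD('p) X (seq_of_padic x)" using X by simp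
  then show "pcauchy CARD('p) (seq_of_padic x)" by (simp add: padic_rel_def)
  with rel X(1) have "padic_of_seq X = (padic_of_seq (seq_of_padic x) :: 'p padic)"
    by (subst padic_of_seq_eq_iff) (auto simp: padic_rel_def)
  moreover have "padic_of_seq X = x"
    unfolding padic_of_seq_def X(2)[symmetric] by (rule Rep_padic_inverse)
  ultimately show "padic_of_seq (seq_of_padic x) = x" by simp
qed

lemma pnull_seq_of_padic:
  assumes "pcauchy CARD('p) X"
  shows "pnull CARD('p) (\<lambda>n. seq_of_padic (padic_of_seq X :: 'p::prime_card padic) n - X n)"
  by (subst padic_of_seq_eq_iff[symmetric]) (simp_all add: assms)

lemma padic_cases [cases type: padic]:
  obtains X where "x = (padic_of_seq X :: 'p::prime_card padic)" "pcauchy CARD('p) X"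
  by (rule that[of "seq_of_padic x"]) simp_all

instantiation padic :: (prime_card) field
begin

definition zero_padic :: "'a padic" where "0 = padic_of_seq (\<lambda>n. 0)"
definition one_padic :: "'a padic" where "1 = padic_of_seq (\<lambda>n. 1)"
definition plus_padic :: "'a padic \<Rightarrow> 'a padic \<Rightarrow> 'a padic" where
  "x + y = padic_of_seq (\<lambda>n. seq_of_padic x n + seq_of_padic y n)"
definition uminus_padic :: "'a padic \<Rightarrow> 'a padic" where
  "- x = padic_of_seq (\<lambda>n. - seq_of_padic x n)"
definition minus_padic :: "'a padic \<Rightarrow> 'a padic \<Rightarrow> 'a padic" where
  "x - y = x + (- y :: 'a padic)"
definition times_padic :: "'a padic \<Rightarrow> 'a padic \<Rightarrow> 'a padic" where
  "x * y = padic_of_seq (\<lambda>n. seq_of_padic x n * seq_of_padic y n)"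
definition inverse_padic :: "'a padic \<Rightarrow> 'a padic" where
  "inverse x = (if x = 0 then 0 else padic_of_seq (\<lambda>n. inverse (seq_of_padic x n)))"
definition divide_padic :: "'a padic \<Rightarrow> 'a padic \<Rightarrow> 'a padic" where
  "x div y = x * inverse (y :: 'a padic)"

lemma plus_padic_of_seq:
  assumes X: "pcauchy CARD('a) X" and Y: "pcauchy CARD('a) Y"
  shows "padic_of_seq X + padic_of_seq Y = (padic_of_seq (\<lambda>n. X n + Y n) :: 'a padic)"
  unfolding plus_padic_def
proof (subst padic_of_seq_eq_iff)
  let ?x = "padic_of_seq X :: 'a padic" and ?y = "padic_of_seq Y :: 'a padic"
  show "pnull CARD('a) (\<lambda>n. seq_of_padic ?x n + seq_of_padic ?y n - (X n + Y n))"
    using pnull_add[OF _ pnull_seq_of_padic[OF X] pnull_seq_of_padic[OF Y]]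
    by (simp add: add_diff_add)
qed (auto intro!: pcauchy_add assms)

lemma uminus_padic_of_seq:
  assumes X: "pcauchy CARD('a) X"
  shows "- padic_of_seq X = (padic_of_seq (\<lambda>n. - X n) :: 'a padic)"
  unfolding uminus_padic_def
proof (subst padic_of_seq_eq_iff)
  let ?x = "padic_of_seq X :: 'a padic"
  show "pnull CARD('a) (\<lambda>n. - seq_of_padic ?x n - - X n)"
    using pnull_minus[OF pnull_seq_of_padic[OF X]]
    by (simp add: minus_diff_minus)
qed (auto intro!: pcauchy_minus assms)

lemma times_padic_of_seq:
  assumes X: "pcauchy CARD('a) X" and Y: "pcauchy CARD('a) Y"
  shows "padic_of_seq X * padic_of_seq Y = (padic_of_seq (\<lambda>n. X n * Y n) :: 'a padic)"
  unfolding times_padic_def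
proof (subst padic_of_seq_eq_iff)
  let ?x = "padic_of_seq X :: 'a padic" and ?y = "padic_of_seq Y :: 'a padic"
  have "pnull CARD('a) (\<lambda>n. seq_of_padic ?x n * (seq_of_padic ?y n - Y n)
      + Y n * (seq_of_padic ?x n - X n))"
    by (intro pnull_add pnull_mult_bounded pnull_seq_of_padic) (simp_all add: assms)
  then show "pnull CARD('a) (\<lambda>n. seq_of_padic ?x n * seq_of_padic ?y n - X n * Y n)"
    by (simp add: mult_diff_mult mult.commute)
qed (auto intro!: pcauchy_mult assms)

lemma padic_of_seq_eq_0_iff:
  "pcauchy CARD('a) X \<Longrightarrow> padic_of_seq X = (0 :: 'a padic) \<longleftrightarrow> pnull CARD('a) X"
  unfolding zero_padic_def by (subst padic_of_seq_eq_iff) auto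

lemma inverse_padic_of_seq:
  assumes X: "pcauchy CARD('a) X" "\<not> pnull CARD('a) X"
  shows "inverse (padic_of_seq X) = (padic_of_seq (\<lambda>n. inverse (X n)) :: 'a padic)"
proof -
  let ?x = "padic_of_seq X :: 'a padic"
  have nz: "?x \<noteq> 0" using X by (simp add: padic_of_seq_eq_0_iff)
  have nz': "\<not> pnull CARD('a) (seq_of_padic ?x)"
    using padic_of_seq_eq_0_iff[of "seq_of_padic ?x"] nz by simp
  have "padic_of_seq (\<lambda>n. inverse (seq_of_padic ?x n)) = (padic_of_seq (\<lambda>n. inverse (X n)) :: 'a padic)"
    by (subst padic_of_seq_eq_iff)
       (auto intro!: pcauchy_inverse pnull_diff_inverse pnull_seq_of_padic simp: X nz')
  then show ?thesis using nz by (simp add: inverse_padic_def)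
qed

instance
proof
  fix a b c :: "'a padic"
  obtain X where X: "a = padic_of_seq X" "pcauchy CARD('a) X" by (rule padic_cases)
  obtain Y where Y: "b = padic_of_seq Y" "pcauchy CARD('a) Y" by (rule padic_cases)
  obtain Z where Z: "c = padic_of_seq Z" "pcauchy CARD('a) Z" by (rule padic_cases)
  note s = X Y Z zero_padic_def one_padic_def plus_padic_of_seq uminus_padic_of_seq
    times_padic_of_seq pcauchy_add pcauchy_mult pcauchy_minus
  show "a + b + c = a + (b + c)" by (simp add: s add.assoc)
  show "a + b = b + a" by (simp add: s add.commute)
  show "0 + a = a" by (simp add: s)
  show "- a + a = 0" by (simp add: s)
  show "a - b = a + - b" by (rule minus_padic_def)
  show "a * b * c = a * (b * c)" by (simp add: s mult.assoc)
  show "a * b = b * a" by (simp add: s mult.commute)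
  show "1 * a = a" by (simp add: s)
  show "(a + b) * c = a * c + b * c" by (simp add: s distrib_right)
  show "(0::'a padic) \<noteq> 1"
    unfolding zero_padic_def one_padic_def
    by (subst padic_of_seq_eq_iff) (simp_all add: pnull_def LIMSEQ_const_iff)
  show "inverse a * a = 1" if "a \<noteq> 0"
  proof -
    have nz: "\<not> pnull CARD('a) X" using that X by (simp add: padic_of_seq_eq_0_iff)
    obtain e N where e: "e > 0" "\<And>n. n \<ge> N \<Longrightarrow> pabs CARD('a) (X n) > e"
      using pcauchy_not_pnull[OF _ X(2) nz] by auto
    have "eventually (\<lambda>n. 0 = pabs CARD('a) (inverse (X n) * X n - 1)) sequentially"
      using eventually_ge_at_top[of N]
    proof eventually_elim
      case (elim n)
      then have "X n \<noteq> 0" using e(2)[of n] e(1) by auto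
      then show ?case by simp
    qed
    then have "pnull CARD('a) (\<lambda>n. inverse (X n) * X n - 1)"
      unfolding pnull_def by (rule Lim_transform_eventually[OF tendsto_const])
    then have "padic_of_seq (\<lambda>n. inverse (X n) * X n) = (1 :: 'a padic)"
      unfolding one_padic_def
      by (subst padic_of_seq_eq_iff) (auto intro!: pcauchy_mult pcauchy_inverse X nz)
    then show ?thesis
      using X nz by (simp add: inverse_padic_of_seq times_padic_of_seq pcauchy_inverse)
  qed
  show "a div b = a * inverse b" by (rule divide_padic_def)
  show "inverse (0::'a padic) = 0" by (simp add: inverse_padic_def)
qed

end

subsection \<open>The p-adic absolute value and metric\<close>

definition padic_norm :: "'p::prime_card padic \<Rightarrow> real" where
  "padic_norm x = lim (\<lambda>n. pabs CARD('p) (seq_of_padic x n))"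

lemma padic_norm_of_seq:
  assumes X: "pcauchy CARD('p) X"
  shows "(\<lambda>n. pabs CARD('p) (X n)) \<longlonglongrightarrow> padic_norm (padic_of_seq X :: 'p::prime_card padic)"
proof -
  let ?x = "padic_of_seq X :: 'p padic"
  have "(\<lambda>n. pabs CARD('p) (seq_of_padic ?x n)) \<longlonglongrightarrow> padic_norm ?x"
    unfolding padic_norm_def convergent_LIMSEQ_iff[symmetric]
    by (rule pcauchy_pabs_convergent) auto
  moreover have "(\<lambda>n. pabs CARD('p) (X n) - pabs CARD('p) (seq_of_padic ?x n)) \<longlonglongrightarrow> 0"
  proof (rule Lim_null_comparison)
    show "eventually (\<lambda>n. norm (pabs CARD('p) (X n) - pabs CARD('p) (seq_of_padic ?x n))
        \<le> pabs CARD('p) (seq_of_padic ?x n - X n)) sequentially"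
      by (metis (mono_tags, lifting) always_eventually pabs_diff_ineq pabs_minus_commute
          prime_card_eq real_norm_def)
    show "(\<lambda>n. pabs CARD('p) (seq_of_padic ?x n - X n)) \<longlonglongrightarrow> 0"
      using pnull_seq_of_padic[OF X] by (simp add: pnull_def)
  qed
  ultimately show ?thesis
    using tendsto_add by fastforce
qed

lemma padic_norm_ge_0 [simp]: "padic_norm (x :: 'p::prime_card padic) \<ge> 0"
  by (cases x) (auto intro: LIMSEQ_le_const[OF padic_norm_of_seq])

lemma padic_norm_eq_0 [simp]: "padic_norm (x :: 'p::prime_card padic) = 0 \<longleftrightarrow> x = 0"
proof (cases x)
  case (1 X)
  then show ?thesis
    using padic_norm_of_seq[OF 1(2)] LIMSEQ_unique
    by (auto simp: padic_of_seq_eq_0_iff pnull_def)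
qed

lemma padic_norm_0 [simp]: "padic_norm (0 :: 'p::prime_card padic) = 0"
  by simp

lemma padic_norm_minus [simp]: "padic_norm (- x :: 'p::prime_card padic) = padic_norm x"
proof (cases x)
  case (1 X)
  show ?thesis
    using padic_norm_of_seq[OF pcauchy_minus[OF 1(2)]] padic_norm_of_seq[OF 1(2)]
    by (auto simp: 1 uminus_padic_of_seq intro: LIMSEQ_unique)
qed

lemma padic_norm_minus_commute: "padic_norm (x - y :: 'p::prime_card padic) = padic_norm (y - x)"
  by (metis minus_diff_eq padic_norm_minus)

lemma padic_norm_mult: "padic_norm (x * y :: 'p::prime_card padic) = padic_norm x * padic_norm y"
proof (cases x; cases y)
  fix X Y assume X: "x = padic_of_seq X" "pcauchy CARD('p) X" and Y: "y = padic_of_seq Y" "pcauchy CARD('p) Y"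
  have "(\<lambda>n. pabs CARD('p) (X n * Y n)) \<longlonglongrightarrow> padic_norm x * padic_norm y"
    unfolding X(1) Y(1) pabs_mult[OF prime_card] by (intro tendsto_mult padic_norm_of_seq X Y)
  then show ?thesis
    using padic_norm_of_seq[OF pcauchy_mult[OF _ X(2) Y(2)]]
    by (auto simp: X Y times_padic_of_seq intro: LIMSEQ_unique)
qed

lemma padic_norm_ultrametric: "padic_norm (x + y :: 'p::prime_card padic) \<le> max (padic_norm x) (padic_norm y)"
proof (cases x; cases y)
  fix X Y assume X: "x = padic_of_seq X" "pcauchy CARD('p) X" and Y: "y = padic_of_seq Y" "pcauchy CARD('p) Y"
  have "(\<lambda>n. pabs CARD('p) (X n + Y n)) \<longlonglongrightarrow> padic_norm (x + y)"
    using padic_norm_of_seq[OF pcauchy_add[OF _ X(2) Y(2)]]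
    by (simp add: X Y plus_padic_of_seq)
  moreover have "(\<lambda>n. max (pabs CARD('p) (X n)) (pabs CARD('p) (Y n))) \<longlonglongrightarrow> max (padic_norm x) (padic_norm y)"
    unfolding X(1) Y(1) by (intro tendsto_max padic_norm_of_seq X Y)
  ultimately show ?thesis
    by (rule LIMSEQ_le) (simp add: pabs_ultrametric)
qed

instantiation padic :: (prime_card) metric_space
begin

definition dist_padic :: "'a padic \<Rightarrow> 'a padic \<Rightarrow> real" where
  "dist_padic x y = padic_norm (x - y)"
definition uniformity_padic :: "('a padic \<times> 'a padic) filter" where
  "uniformity_padic = (INF e\<in>{0<..}. principal {(x, y). dist x (y :: 'a padic) < e})"
definition open_padic :: "'a padic set \<Rightarrow> bool" where
  "open_padic U \<longleftrightarrow> (\<forall>x\<in>U. eventually (\<lambda>(x', y). x' = x \<longrightarrow> y \<in> U) uniformity)"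

instance
proof
  fix x y z :: "'a padic"
  show "dist x y = 0 \<longleftrightarrow> x = y" by (simp add: dist_padic_def)
  have "padic_norm (x - y) \<le> max (padic_norm (x - z)) (padic_norm (z - y))"
    using padic_norm_ultrametric[of "x - z" "z - y"] by simp
  also have "\<dots> \<le> padic_norm (x - z) + padic_norm (z - y)" by simp
  finally show "dist x y \<le> dist x z + dist y z"
    by (simp add: dist_padic_def padic_norm_minus_commute)
qed (simp_all add: uniformity_padic_def open_padic_def)

end

lemma dist_padic_le_iff:
  assumes "dist x y \<le> r"
  shows "dist x z \<le> r \<longleftrightarrow> dist y (z :: 'p::prime_card padic) \<le> r"
proof -
  have "dist a c \<le> r" if "dist a b \<le> r" "dist b c \<le> r" for a b c :: "'p padic"
    using that padic_norm_ultrametric[of "a - b" "b - c"] by (simp add: dist_padic_def)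
  then show ?thesis using assms by (metis dist_commute)
qed


section \<open>Haar measure\<close>

text \<open>Regularity and finiteness on compact sets need not be required: a translation invariant
  Borel measure giving finite mass to the open subgroup of p-adic integers is finite on compact sets,
  and on this separable, locally compact metric space it is then regular.\<close>

definition normalized_haar :: "'p::prime_card padic measure \<Rightarrow> bool" where
  "normalized_haar M \<longleftrightarrow> sets M = sets borel
     \<and> (\<forall>a. \<forall>A\<in>sets borel. emeasure M ((\<lambda>x. a + x) ` A) = emeasure M A)
     \<and> emeasure M {x. padic_norm x \<le> 1} = 1"

subsection \<open>Existence\<close>

text \<open>Haar measure is obtained as the image of Lebesgue measure on the nonnegative reals under the map
  that reads the base-p expansion of a real number backwards.\<close>

fun digit_rev :: "nat \<Rightarrow> nat \<Rightarrow> rat" where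
  "digit_rev p m = (if p \<le> 1 \<or> m = 0 then 0
     else of_nat (m mod p) + digit_rev p (m div p) / of_nat p)"

declare digit_rev.simps [simp del]

lemma digit_rev_rec:
  "p > 1 \<Longrightarrow> digit_rev p m = of_nat (m mod p) + digit_rev p (m div p) / of_nat p"
  by (cases "m = 0") (simp_all add: digit_rev.simps[of p m] digit_rev.simps[of p 0])

lemma pabs_of_int: "prime p \<Longrightarrow> b \<noteq> 0 \<Longrightarrow> pabs p (of_int b) = real p powi (- int (multiplicity (int p) b))"
  using pabs_divide[of p b 1] by simp

lemma pabs_of_int_le_1: "prime p \<Longrightarrow> pabs p (of_int b) \<le> 1"
  using prime_gt_0_nat[of p]
  by (cases "b = 0") (auto simp: pabs_of_int power_int_minus_left power_int_def field_simps)

lemma pabs_of_int_eq_1: "prime p \<Longrightarrow> \<not> int p dvd b \<Longrightarrow> pabs p (of_int b) = 1"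
  by (cases "b = 0") (auto simp: pabs_of_int not_dvd_imp_multiplicity_0)

lemma pabs_of_nat_self: "prime p \<Longrightarrow> pabs p (of_nat p) = 1 / p"
proof -
  assume p: "prime p"
  have p1: "p > 1" using prime_gt_1_nat[OF p] .
  have "multiplicity (int p) (int p) = 1"
    by (rule multiplicity_self) (use p1 in auto)
  then show ?thesis
    using pabs_of_int[OF p, of "int p"] p1 by (simp add: power_int_minus field_simps)
qed

lemma pabs_of_int_dvd: 
  assumes p: "prime p" and "int p dvd b" shows "pabs p (of_int b) \<le> 1 / p"
proof -
  obtain c where c: "b = int p * c" using assms by auto
  show ?thesis
    using pabs_of_int_le_1[OF p, of c] p
    by (simp add: c pabs_mult pabs_of_nat_self divide_right_mono)
qed

lemma pabs_p_powi:
  assumes p: "prime p"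
  shows "pabs p (of_nat p powi k) = real p powi (- k)"
proof -
  note 1 = pabs_of_nat_self[OF p]
  have 2: "pabs p (of_nat p ^ n) = (1 / p) ^ n" for n
    by (induction n) (simp_all add: pabs_mult[OF p] 1)
  show ?thesis
    by (auto simp: power_int_def 2 pabs_inverse[OF p] power_one_over power_inverse simp flip: inverse_eq_divide)
qed

lemma digit_rev_separated:
  assumes p: "prime p"
  shows "m \<noteq> m' \<Longrightarrow> pabs p (digit_rev p m - digit_rev p m') \<ge> 1"
proof (induction "m + m'" arbitrary: m m' rule: less_induct)
  case less
  have p1: "p > 1" using prime_gt_1_nat[OF p] .
  define a where "a = int (m mod p) - int (m' mod p)"
  define b where "b = (digit_rev p (m div p) - digit_rev p (m' div p)) / of_nat p"
  have eq: "digit_rev p m - digit_rev p m' = of_int a + b"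
    by (simp add: digit_rev_rec[OF p1, of m] digit_rev_rec[OF p1, of m'] a_def b_def diff_divide_distrib)
  show ?case
  proof (cases "m div p = m' div p")
    case True
    then have "m mod p \<noteq> m' mod p" using less.prems by (metis div_mult_mod_eq)
    then have "a \<noteq> 0" by (simp add: a_def)
    moreover have "\<bar>a\<bar> < int p"
      using mod_less_divisor[of p m] mod_less_divisor[of p m'] p1 unfolding a_def by linarith
    ultimately have "\<not> int p dvd a" using dvd_imp_le_int[of a "int p"] by auto
    then have "pabs p (of_int a) = 1" using p by (rule pabs_of_int_eq_1[rotated])
    then show ?thesis using True by (simp add: eq b_def)
  next
    case False
    have "m div p + m' div p < m + m'"
      using div_less_dividend[of p m] div_less_dividend[of p m'] p1 less.prems
        div_le_dividend[of m p] div_le_dividend[of m' p]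
      by (cases "m = 0"; cases "m' = 0") linarith+
    then have "pabs p (digit_rev p (m div p) - digit_rev p (m' div p)) \<ge> 1"
      using less.hyps False by blast
    then have "pabs p b \<ge> p"
      using p1 unfolding b_def divide_inverse pabs_mult[OF p] pabs_inverse[OF p] pabs_of_nat_self[OF p]
      by simp
    moreover have "pabs p b \<le> max (pabs p (of_int a + b)) (pabs p (of_int a))"
      using pabs_ultrametric[OF p, of "of_int a + b" "- of_int a"] by simp
    moreover have "pabs p (of_int a) \<le> 1" by (rule pabs_of_int_le_1[OF p])
    ultimately show ?thesis unfolding eq using p1 by linarith
  qed
qed


lemma pabs_residue:
  assumes p: "prime p" and z: "pabs p z \<le> 1"
  shows "\<exists>d<p. pabs p (z - of_nat d) \<le> 1 / p"
proof -
  have p1: "p > 1" using prime_gt_1_nat[OF p] .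
  obtain a b where q: "quotient_of z = (a, b)" by (cases "quotient_of z")
  have b: "b > 0" and cop: "coprime a b" and zab: "z = of_int a / of_int b"
    using quotient_of_denom_pos[OF q] quotient_of_coprime[OF q] quotient_of_div[OF q] by auto
  have nd: "\<not> int p dvd b"
  proof
    assume pb: "int p dvd b"
    then have "\<not> int p dvd a" using coprime_common_divisor[OF cop, of "int p"] p1 by auto
    then have "a \<noteq> 0" "pabs p (of_int a) = 1" using pabs_of_int_eq_1[OF p] by auto
    moreover have "pabs p (of_int a) = pabs p z * pabs p (of_int b)"
      using b by (simp add: zab flip: pabs_mult[OF p])
    moreover have "\<dots> \<le> 1 * (1 / p)"
      by (intro mult_mono z pabs_of_int_dvd[OF p pb]) auto
    ultimately show False using p1 by simp
  qed
  then have "coprime b (int p)"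
    using prime_imp_coprime[of "int p" b] p by (simp add: coprime_commute)
  then obtain u v where uv: "u * b + v * int p = 1"
    using bezout_int[of b "int p"] by auto
  define d where "d = nat ((a * u) mod int p)"
  have d: "int d = (a * u) mod int p" "d < p" using p1 by (simp_all add: d_def nat_less_iff)
  have "a * u - int d = int p * ((a * u) div int p)"
    unfolding d(1) by (simp add: minus_mod_eq_mult_div)
  moreover have "a - int d * b = a * (u * b + v * int p) - int d * b" by (simp add: uv)
  then have "a - int d * b = (a * u - int d) * b + int p * (a * v)" by (simp add: algebra_simps)
  ultimately have "int p dvd a - int d * b" by simp
  then have 1: "pabs p (of_int (a - int d * b)) \<le> 1 / p" by (rule pabs_of_int_dvd[OF p])
  have "of_int (a - int d * b) = (z - of_nat d) * of_int b"
    using b by (simp add: zab field_simps)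
  then have "pabs p (z - of_nat d) \<le> 1 / p"
    using 1 pabs_of_int_eq_1[OF p nd] by (simp add: pabs_mult[OF p])
  then show ?thesis using d(2) by blast
qed

lemma digit_rev_approx:
  assumes p: "prime p"
  shows "\<exists>m. pabs p (x - digit_rev p m) \<le> 1 / p"
proof -
  have p1: "p > 1" using prime_gt_1_nat[OF p] .
  have *: "\<exists>m. pabs p (x - digit_rev p m) \<le> 1 / p" if "real p * pabs p x \<le> real p ^ k" for k x
    using that
  proof (induction k arbitrary: x)
    case 0
    then show ?case using p1
      by (intro exI[of _ 0]) (simp add: digit_rev.simps[of p 0] field_simps)
  next
    case (Suc k)
    have "real p * pabs p (of_nat p * x) \<le> real p ^ k"
      using Suc.prems p1 by (simp add: pabs_mult[OF p] pabs_of_nat_self[OF p])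
    then obtain m where m: "pabs p (of_nat p * x - digit_rev p m) \<le> 1 / p" using Suc.IH by blast
    define z where "z = x - digit_rev p m / of_nat p"
    have "of_nat p * x - digit_rev p m = of_nat p * z" using p1 by (simp add: z_def field_simps)
    then have "pabs p z \<le> 1"
      using m p1 by (simp add: pabs_mult[OF p] pabs_of_nat_self[OF p] field_simps)
    then obtain d where d: "d < p" "pabs p (z - of_nat d) \<le> 1 / p" using pabs_residue[OF p] by blast
    have "digit_rev p (p * m + d) = of_nat d + digit_rev p m / of_nat p"
      using d p1 by (subst digit_rev_rec) auto
    then have "x - digit_rev p (p * m + d) = z - of_nat d" by (simp add: z_def)
    then show ?case using d by metis
  qed
  obtain k where "real p * pabs p x < real p ^ k" using real_arch_pow[of "real p"] p1 by auto
  then show ?thesis using * less_imp_le by blast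
qed

definition padic_of_rat :: "rat \<Rightarrow> 'p::prime_card padic" where
  "padic_of_rat r = padic_of_seq (\<lambda>_. r)"

lemma dist_padic_of_seq:
  assumes X: "pcauchy CARD('p) X" and Y: "pcauchy CARD('p) Y"
  shows "(\<lambda>n. pabs CARD('p) (X n - Y n)) \<longlonglongrightarrow> dist (padic_of_seq X) (padic_of_seq Y :: 'p::prime_card padic)"
  using padic_norm_of_seq[OF pcauchy_add[OF _ X pcauchy_minus[OF Y]]] X Y
  by (simp add: dist_padic_def minus_padic_def uminus_padic_of_seq plus_padic_of_seq pcauchy_minus)

lemma dist_padic_of_rat:
  "dist (padic_of_rat a) (padic_of_rat b :: 'p::prime_card padic) = pabs CARD('p) (a - b)"
  using dist_padic_of_seq[of "\<lambda>_. a" "\<lambda>_. b"] unfolding padic_of_rat_def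
  by (metis LIMSEQ_const_iff pcauchy_const)

lemma padic_of_rat_dense:
  assumes "e > 0"
  shows "\<exists>r. dist (c :: 'p::prime_card padic) (padic_of_rat r) \<le> e"
proof (cases c)
  case (1 X)
  obtain N where N: "\<forall>m\<ge>N. \<forall>n\<ge>N. pabs CARD('p) (X m - X n) < e"
    using 1(2) assms unfolding pcauchy_def by blast
  have "(\<lambda>n. pabs CARD('p) (X n - X N)) \<longlonglongrightarrow> dist c (padic_of_rat (X N))"
    unfolding padic_of_rat_def 1(1) by (rule dist_padic_of_seq) (simp_all add: 1)
  then have "dist c (padic_of_rat (X N)) \<le> e"
    using N by (intro LIMSEQ_le_const2) (auto intro: less_imp_le)
  then show ?thesis by blast
qed

definition digit_pt :: "nat \<Rightarrow> int \<Rightarrow> nat \<Rightarrow> rat" where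
  "digit_pt p n m = of_nat p powi (n - 1) * digit_rev p m"

lemma digit_pt_unique:
  assumes p: "prime p" and "pabs p (digit_pt p n m - digit_pt p n m') \<le> real p powi (- n)"
  shows "m = m'"
proof (rule ccontr)
  have p1: "real p > 1" using prime_gt_1_nat[OF p] by simp
  assume "m \<noteq> m'"
  then have "pabs p (digit_rev p m - digit_rev p m') \<ge> 1" by (rule digit_rev_separated[OF p])
  then have "real p powi (- (n - 1)) * 1 \<le> real p powi (- (n - 1)) * pabs p (digit_rev p m - digit_rev p m')"
    using p1 by (intro mult_left_mono) auto
  also have "\<dots> = pabs p (digit_pt p n m - digit_pt p n m')"
    by (simp add: digit_pt_def pabs_mult[OF p] pabs_p_powi[OF p] flip: right_diff_distrib)
  also have "\<dots> \<le> real p powi (- n)" by fact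
  also have "\<dots> < real p powi (- (n - 1))"
    using p1 by (intro power_int_strict_increasing) auto
  finally show False by simp
qed

lemma digit_pt_approx:
  "\<exists>m. dist (c :: 'p::prime_card padic) (padic_of_rat (digit_pt CARD('p) n m)) \<le> real CARD('p) powi (- n)"
proof -
  let ?p = "CARD('p)"
  have p: "prime ?p" by simp
  have p1: "real ?p > 1" using prime_gt_1_nat[OF p] by simp
  then have "real ?p powi (- n) > 0" by simp
  then obtain r where r: "dist c (padic_of_rat r) \<le> real ?p powi (- n)" using padic_of_rat_dense by blast
  obtain m where m: "pabs ?p (r * of_nat ?p powi (1 - n) - digit_rev ?p m) \<le> 1 / ?p"
    using digit_rev_approx[OF p] by blast
  have "(of_nat ?p :: rat) powi (n - 1) * of_nat ?p powi (1 - n) = 1"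
    using p1 by (simp flip: power_int_add)
  then have "r - digit_pt ?p n m = of_nat ?p powi (n - 1) * (r * of_nat ?p powi (1 - n) - digit_rev ?p m)"
    by (simp add: digit_pt_def algebra_simps)
  then have "pabs ?p (r - digit_pt ?p n m) \<le> real ?p powi (- (n - 1)) * (1 / ?p)"
    using m p1 by (simp only: pabs_mult[OF p] pabs_p_powi[OF p]) (intro mult_left_mono, auto)
  also have "\<dots> = real ?p powi (- n)" using p1 by (simp add: power_int_diff power_int_minus field_simps)
  finally have "dist (padic_of_rat r :: 'p padic) (padic_of_rat (digit_pt ?p n m)) \<le> real ?p powi (- n)"
    by (simp add: dist_padic_of_rat)
  with r show ?thesis using dist_padic_le_iff by blast
qed

definition digit_seq :: "nat \<Rightarrow> real \<Rightarrow> int \<Rightarrow> rat" where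
  "digit_seq p t n = digit_pt p n (nat \<lfloor>t * real p powi n\<rfloor>)"

lemma digit_seq_step:
  assumes p: "prime p" and t: "t \<ge> 0"
  shows "pabs p (digit_seq p t (n + 1) - digit_seq p t n) \<le> real p powi (- n)"
proof -
  have p1: "p > 1" using prime_gt_1_nat[OF p] .
  define M where "M = nat \<lfloor>t * real p powi (n + 1)\<rfloor>"
  have "\<lfloor>t * real p powi n\<rfloor> = \<lfloor>t * real p powi (n + 1) / real_of_int (int p)\<rfloor>"
    using p1 by (simp add: power_int_add)
  also have "\<dots> = \<lfloor>t * real p powi (n + 1)\<rfloor> div int p"
    by (rule floor_divide_real_eq_div) simp
  finally have "nat \<lfloor>t * real p powi n\<rfloor> = M div p"
    using t by (simp add: M_def nat_div_distrib)
  then have "digit_seq p t (n + 1) - digit_seq p t n = of_nat p powi n * of_nat (M mod p)"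
    using p1 unfolding digit_seq_def M_def[symmetric] digit_pt_def
    by (subst digit_rev_rec[of p M]) (simp_all add: power_int_diff field_simps)
  then show ?thesis
    using pabs_of_int_le_1[OF p, of "int (M mod p)"] p1
    by (simp add: pabs_mult[OF p] pabs_p_powi[OF p] mult_left_le)
qed

lemma digit_seq_close:
  assumes p: "prime p" and t: "t \<ge> 0" and "k \<ge> n"
  shows "pabs p (digit_seq p t k - digit_seq p t n) \<le> real p powi (- n)"
  using \<open>k \<ge> n\<close>
proof (induction k rule: int_ge_induct)
  case base
  then show ?case by simp
next
  case (step k)
  have "real p > 1" using prime_gt_1_nat[OF p] by simp
  then have "real p powi (- k) \<le> real p powi (- n)" using step by (intro power_int_increasing) auto
  then show ?case
    using pabs_ultrametric[OF p, of "digit_seq p t (k + 1) - digit_seq p t k" "digit_seq p t k - digit_seq p t n"]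
      digit_seq_step[OF p t, of k] step.IH by simp
qed

lemma powi_arbitrarily_small:
  assumes "(b::real) > 1" "e > 0"
  shows "\<exists>n::nat. b powi (- int n) < e"
proof -
  obtain n where "(1 / b) ^ n < e" using real_arch_pow_inv[of e "1 / b"] assms by auto
  then show ?thesis using assms by (auto simp: power_int_minus power_divide field_simps intro!: exI[of _ n])
qed

lemma pcauchy_digit_seq:
  assumes p: "prime p" and t: "t \<ge> 0"
  shows "pcauchy p (\<lambda>n. digit_seq p t (int n))"
  unfolding pcauchy_def
proof (intro allI impI)
  fix e :: real assume "e > 0"
  then obtain N where N: "real p powi (- int N) < e"
    using powi_arbitrarily_small[of "real p" e] prime_gt_1_nat[OF p] by auto
  show "\<exists>N. \<forall>m\<ge>N. \<forall>n\<ge>N. pabs p (digit_seq p t (int m) - digit_seq p t (int n)) < e"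
  proof (rule exI[of _ N], intro allI impI)
    fix m n assume "m \<ge> N" "n \<ge> N"
    then have "pabs p (digit_seq p t (int m) - digit_seq p t (int N)) \<le> real p powi (- int N)"
      "pabs p (digit_seq p t (int n) - digit_seq p t (int N)) \<le> real p powi (- int N)"
      by (auto intro!: digit_seq_close p t)
    then show "pabs p (digit_seq p t (int m) - digit_seq p t (int n)) < e"
      using N pabs_ultrametric[OF p, of "digit_seq p t (int m) - digit_seq p t (int N)" 
          "digit_seq p t (int N) - digit_seq p t (int n)"] pabs_minus_commute[of p "digit_seq p t (int n)"]
      by simp
  qed
qed

definition digit_map :: "real \<Rightarrow> 'p::prime_card padic" where
  "digit_map t = padic_of_seq (\<lambda>n. digit_seq CARD('p) t (int n))"

lemma digit_map_close:
  assumes t: "t \<ge> 0"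
  shows "dist (digit_map t :: 'p::prime_card padic) (padic_of_rat (digit_seq CARD('p) t n)) \<le> real CARD('p) powi (- n)"
proof -
  have p: "prime CARD('p)" by simp
  have "(\<lambda>j. pabs CARD('p) (digit_seq CARD('p) t (int j) - digit_seq CARD('p) t n))
      \<longlonglongrightarrow> dist (digit_map t :: 'p padic) (padic_of_rat (digit_seq CARD('p) t n))"
    unfolding digit_map_def padic_of_rat_def
    by (intro dist_padic_of_seq pcauchy_digit_seq t) auto
  then show ?thesis
  proof (rule LIMSEQ_le_const2)
    show "\<exists>N. \<forall>j\<ge>N. pabs CARD('p) (digit_seq CARD('p) t (int j) - digit_seq CARD('p) t n) \<le> real CARD('p) powi (- n)"
      by (intro exI[of _ "nat n"] allI impI digit_seq_close[OF p t]) linarith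
  qed
qed

lemma digit_map_vimage:
  fixes c :: "'p::prime_card padic"
  shows "\<exists>m::nat. digit_map -` cball c (real CARD('p) powi (- n)) \<inter> {0..}
      = {real m * real CARD('p) powi (- n)..<(real m + 1) * real CARD('p) powi (- n)}"
proof -
  let ?p = "CARD('p)" and ?r = "real CARD('p) powi (- n)"
  have p: "prime ?p" by simp
  have p1: "real ?p > 1" using prime_gt_1_nat[OF p] by simp
  obtain m where m: "dist c (padic_of_rat (digit_pt ?p n m)) \<le> ?r" using digit_pt_approx by blast
  have "digit_map t \<in> cball c ?r \<longleftrightarrow> t \<in> {real m * ?r..<(real m + 1) * ?r}" if t: "t \<ge> 0" for t
  proof -
    have "digit_map t \<in> cball c ?r \<longleftrightarrow> dist (padic_of_rat (digit_pt ?p n m)) (digit_map t :: 'p padic) \<le> ?r"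
      using dist_padic_le_iff[OF m] by simp
    also have "\<dots> \<longleftrightarrow> dist (digit_map t :: 'p padic) (padic_of_rat (digit_pt ?p n m)) \<le> ?r"
      by (simp add: dist_commute)
    also have "\<dots> \<longleftrightarrow> dist (padic_of_rat (digit_seq ?p t n) :: 'p padic) (padic_of_rat (digit_pt ?p n m)) \<le> ?r"
      by (rule dist_padic_le_iff[OF digit_map_close[OF t]])
    also have "\<dots> \<longleftrightarrow> nat \<lfloor>t * real ?p powi n\<rfloor> = m"
      using digit_pt_unique[OF p] p1 by (auto simp: dist_padic_of_rat digit_seq_def)
    also have "\<dots> \<longleftrightarrow> real m \<le> t * real ?p powi n \<and> t * real ?p powi n < real m + 1"
      using t p1 by (auto simp: nat_eq_iff floor_eq_iff)
    also have "\<dots> \<longleftrightarrow> t \<in> {real m * ?r..<(real m + 1) * ?r}"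
      using p1 by (simp add: power_int_minus field_simps)
    finally show ?thesis .
  qed
  moreover have "t \<ge> 0" if "t \<in> {real m * ?r..<(real m + 1) * ?r}" for t
  proof -
    have "0 \<le> real m * ?r" by simp
    then show ?thesis using that unfolding atLeastLessThan_iff atLeast_iff by linarith
  qed
  ultimately show ?thesis by (intro exI[of _ m]) blast
qed

definition padic_balls :: "'p::prime_card padic set set" where
  "padic_balls = insert {} (range (\<lambda>(c, n). cball c (real CARD('p) powi n)))"

lemma cball_padic_eq: "dist x y \<le> r \<Longrightarrow> cball x r = cball (y :: 'p::prime_card padic) r"
  by (auto simp: dist_padic_le_iff[of x y r])

lemma Int_stable_padic_balls: "Int_stable (padic_balls :: 'p::prime_card padic set set)"
proof (rule Int_stableI)
  have *: "cball c r \<inter> cball d s \<in> {{}, cball c r}" if "r \<le> s" for c d :: "'p padic" and r s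
  proof (cases "cball c r \<inter> cball d s = {}")
    case False
    then obtain z where z: "dist c z \<le> r" "dist d z \<le> s" by auto
    then have "cball c r = cball z r" "cball d s = cball z s" by (auto intro!: cball_padic_eq)
    then show ?thesis using that by auto
  qed simp
  fix A B :: "'p padic set" assume A: "A \<in> padic_balls" and B: "B \<in> padic_balls"
  show "A \<inter> B \<in> padic_balls"
  proof (cases "A = {} \<or> B = {}")
    case True
    then show ?thesis by (auto simp: padic_balls_def)
  next
    case False
    then obtain c r d s where AB: "A = cball c r" "B = cball d s" using A B by (auto simp: padic_balls_def)
    have "A \<inter> B \<in> {{}, A, B}"
      using *[of r s c d] *[of s r d c] unfolding AB by (cases "r \<le> s") auto
    then show ?thesis using A B by (auto simp: padic_balls_def)
  qed
qed

lemma sets_borel_padic: "sets (borel :: 'p::prime_card padic measure) = sigma_sets UNIV padic_balls"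
proof -
  let ?p = "CARD('p)"
  have p1: "real ?p > 1" using prime_gt_1_nat[OF prime_card] by simp
  define G :: "int \<times> nat \<Rightarrow> 'p padic set" where
    "G = (\<lambda>(n, m). cball (padic_of_rat (digit_pt ?p n m)) (real ?p powi (- n)))"
  have open_in: "U \<in> sigma_sets UNIV padic_balls" if U: "open U" for U :: "'p padic set"
  proof -
    have "U = \<Union>(G ` {i. G i \<subseteq> U})"
    proof (intro equalityI subsetI)
      fix x assume "x \<in> U"
      then obtain e where e: "e > 0" "cball x e \<subseteq> U" using U open_contains_cball by blast
      obtain n where n: "real ?p powi (- int n) < e" using powi_arbitrarily_small[OF p1 e(1)] by blast
      obtain m where m: "dist x (padic_of_rat (digit_pt ?p (int n) m)) \<le> real ?p powi (- int n)"
        using digit_pt_approx by blast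
      have "G (int n, m) = cball x (real ?p powi (- int n))"
        unfolding G_def using cball_padic_eq[OF m] by simp
      moreover have "\<dots> \<subseteq> cball x e" using n by auto
      moreover have "x \<in> cball x (real ?p powi (- int n))" using p1 by simp
      ultimately show "x \<in> \<Union>(G ` {i. G i \<subseteq> U})" using e(2) by blast
    qed auto
    moreover have "\<Union>(G ` {i. G i \<subseteq> U}) \<in> sets (sigma UNIV padic_balls)"
      by (intro sets.countable_UN') (auto simp: G_def padic_balls_def intro!: in_measure_of)
    ultimately show ?thesis by simp
  qed
  have "sigma_sets UNIV {S :: 'p padic set. open S} = sigma_sets UNIV padic_balls"
  proof (rule sigma_sets_eqI)
    fix B :: "'p padic set" assume "B \<in> padic_balls"
    then have "closed B" by (auto simp: padic_balls_def)
    then have "B \<in> sets borel" by simp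
    then show "B \<in> sigma_sets UNIV {S. open S}" by (simp add: borel_def)
  qed (use open_in in auto)
  then show ?thesis by (simp add: borel_def)
qed

lemma Ico_mult_subset: "{real m * real k powi n..<(real m + 1) * real k powi n} \<subseteq> {0..}"
proof -
  have "0 \<le> real m * real k powi n" by simp
  then show ?thesis unfolding subset_eq Ball_def atLeastLessThan_iff atLeast_iff
    by (meson order_trans)
qed

definition digit_measure :: "'p::prime_card padic measure" where
  "digit_measure = distr (restrict_space lborel {0..}) borel digit_map"

lemma measurable_digit_map:
  "(digit_map :: real \<Rightarrow> 'p::prime_card padic) \<in> measurable (restrict_space lborel {0..}) borel"
proof (rule measurable_sigma_sets[OF sets_borel_padic])
  fix B :: "'p padic set" assume "B \<in> padic_balls"
  then consider "B = {}" | c n where "B = cball c (real CARD('p) powi (- n))"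
    unfolding padic_balls_def by (auto) (metis minus_minus)
  then show "digit_map -` B \<inter> space (restrict_space lborel {0..}) \<in> sets (restrict_space lborel {0..})"
  proof cases
    case 2
    then obtain m :: nat where "digit_map -` B \<inter> {0..} = {real m * real CARD('p) powi (- n)..<(real m + 1) * real CARD('p) powi (- n)}"
      using digit_map_vimage by blast
    moreover have "{real m * real CARD('p) powi (- n)..<(real m + 1) * real CARD('p) powi (- n)} \<subseteq> {0..}"
      by (rule Ico_mult_subset)
    ultimately show ?thesis
      by (auto simp: space_restrict_space sets_restrict_space_iff)
  qed simp
qed auto

lemma emeasure_digit_measure_cball:
  "emeasure digit_measure (cball (c :: 'p::prime_card padic) (real CARD('p) powi n)) = ennreal (real CARD('p) powi n)"
proof -
  let ?r = "real CARD('p) powi n"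
  obtain m :: nat where m: "digit_map -` cball c ?r \<inter> {0..} = {real m * ?r..<(real m + 1) * ?r}"
    using digit_map_vimage[of c "- n"] by auto
  have sub: "{real m * ?r..<(real m + 1) * ?r} \<subseteq> {0..}"
    by (rule Ico_mult_subset)
  have "emeasure digit_measure (cball c ?r) = emeasure (restrict_space lborel {0..}) {real m * ?r..<(real m + 1) * ?r}"
    unfolding digit_measure_def
    by (subst emeasure_distr[OF measurable_digit_map]) (simp_all add: m space_restrict_space)
  also have "\<dots> = emeasure lborel {real m * ?r..<(real m + 1) * ?r}"
    using sub by (intro emeasure_restrict_space) auto
  also have "\<dots> = ennreal ?r"
    by (subst emeasure_lborel_Ico) (auto intro!: mult_right_mono simp: algebra_simps)
  finally show ?thesis .
qed

lemma padic_measure_eqI: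
  fixes M N :: "'p::prime_card padic measure"
  assumes "sets M = sets borel" "sets N = sets borel"
    and "\<And>c n. emeasure M (cball c (real CARD('p) powi n)) = emeasure N (cball c (real CARD('p) powi n))"
    and "\<And>c n. emeasure M (cball c (real CARD('p) powi n)) \<noteq> \<infinity>"
  shows "M = N"
proof (rule measure_eqI_generator_eq)
  let ?A = "\<lambda>i::nat. cball (0 :: 'p padic) (real CARD('p) powi int i)"
  show "Int_stable (padic_balls :: 'p padic set set)" by (rule Int_stable_padic_balls)
  show "padic_balls \<subseteq> Pow (UNIV :: 'p padic set)" by simp
  show "emeasure M X = emeasure N X" if "X \<in> padic_balls" for X
    using that assms(3) by (auto simp: padic_balls_def)
  show "sets M = sigma_sets UNIV padic_balls" "sets N = sigma_sets UNIV padic_balls"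
    using assms sets_borel_padic by auto
  show "range ?A \<subseteq> padic_balls" unfolding padic_balls_def by blast
  show "(\<Union>i. ?A i) = UNIV"
  proof (intro equalityI subsetI UNIV_I)
    fix x :: "'p padic"
    have "real CARD('p) > 1" using prime_gt_1_nat[OF prime_card] by simp
    then obtain i where "dist 0 x < real CARD('p) ^ i" using real_arch_pow by blast
    then show "x \<in> (\<Union>i. ?A i)" by (auto intro!: exI[of _ i])
  qed
  show "emeasure M (?A i) \<noteq> \<infinity>" for i by (rule assms(4))
qed

theorem normalized_haar_exists: "\<exists>M :: 'p::prime_card padic measure. normalized_haar M"
proof
  let ?M = "digit_measure :: 'p padic measure"
  have sets: "sets ?M = sets borel" by (simp add: digit_measure_def)
  have inv: "emeasure ?M ((\<lambda>x. a + x) ` A) = emeasure ?M A" if A: "A \<in> sets borel" for a A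
  proof -
    let ?f = "\<lambda>x. x - a"
    have dist_f: "dist (?f x) (?f y) = dist x y" for x y by (simp add: dist_padic_def)
    have "continuous_on UNIV ?f"
      unfolding continuous_on_iff dist_f by blast
    then have f: "?f \<in> measurable ?M borel"
      using borel_measurable_continuous_onI sets by (metis measurable_cong_sets)
    have vim: "?f -` B \<inter> space ?M = (\<lambda>x. a + x) ` B" for B
      by (auto simp: digit_measure_def image_iff) (metis add.commute diff_add_cancel)
    have "?M = distr ?M borel ?f"
    proof (rule padic_measure_eqI)
      fix c n
      have "(\<lambda>x. a + x) ` cball c (real CARD('p) powi n) = cball (a + c) (real CARD('p) powi n)"
      proof -
        have "y \<in> (\<lambda>x. a + x) ` cball c r \<longleftrightarrow> y \<in> cball (a + c) r" for y r
          by (auto simp: image_iff dist_padic_def intro!: bexI[of _ "y - a"] simp: algebra_simps)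
        then show ?thesis by blast
      qed
      then show "emeasure ?M (cball c (real CARD('p) powi n)) = emeasure (distr ?M borel ?f) (cball c (real CARD('p) powi n))"
        by (simp add: emeasure_distr[OF f] vim emeasure_digit_measure_cball)
    qed (simp_all add: sets emeasure_digit_measure_cball)
    then have "emeasure ?M A = emeasure (distr ?M borel ?f) A" by simp
    also have "\<dots> = emeasure ?M ((\<lambda>x. a + x) ` A)"
      using A by (simp add: emeasure_distr[OF f] vim)
    finally show ?thesis by simp
  qed
  have "{x :: 'p padic. padic_norm x \<le> 1} = cball 0 (real CARD('p) powi 0)"
    by (auto simp: dist_padic_def)
  then show "normalized_haar ?M"
    using sets inv emeasure_digit_measure_cball[of "0 :: 'p padic" 0]
    unfolding normalized_haar_def by simp
qed

definition haar :: "'p::prime_card padic measure" where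
  "haar = (SOME M. normalized_haar M)"

lemma normalized_haar_haar: "normalized_haar haar"
  unfolding haar_def by (rule someI_ex[OF normalized_haar_exists])


section \<open>Block spaces\<close>

text \<open>Functions are Borel measurable representatives of their classes modulo null sets. None of the
  notions below except the support of a block distinguishes functions that agree almost everywhere.\<close>

definition Lr_norm :: "real \<Rightarrow> ('p::prime_card padic \<Rightarrow> complex) \<Rightarrow> real" where
  "Lr_norm r f = (\<integral>x. norm (f x) powr r \<partial>haar) powr (1 / r)"

definition Lr :: "real \<Rightarrow> ('p::prime_card padic \<Rightarrow> complex) set" where
  "Lr r = {f \<in> borel_measurable haar. integrable haar (\<lambda>x. norm (f x) powr r)}"

definition Lr_loc :: "real \<Rightarrow> ('p::prime_card padic \<Rightarrow> complex) set" where
  "Lr_loc r = {f \<in> borel_measurable haar.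
     \<forall>K. compact K \<longrightarrow> set_integrable haar K (\<lambda>x. norm (f x) powr r)}"

definition padic_ball :: "int \<Rightarrow> 'p::prime_card padic set" where
  "padic_ball n = {x. padic_norm x \<le> real CARD('p) powi n}"

definition central_block :: "real \<Rightarrow> real \<Rightarrow> ('p::prime_card padic \<Rightarrow> complex) \<Rightarrow> bool" where
  "central_block r \<alpha> a \<longleftrightarrow> a \<in> Lr r \<and>
     (\<exists>n. closure {x. a x \<noteq> 0} \<subseteq> padic_ball n
        \<and> Lr_norm r a \<le> measure haar (padic_ball n :: 'p padic set) powr (- \<alpha>))"

definition block_decomposition ::
  "real \<Rightarrow> real \<Rightarrow> ('p::prime_card padic \<Rightarrow> complex) \<Rightarrow> (nat \<Rightarrow> complex)
     \<Rightarrow> (nat \<Rightarrow> 'p padic \<Rightarrow> complex) \<Rightarrow> bool" where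
  "block_decomposition r \<alpha> f l a \<longleftrightarrow>
     summable (\<lambda>k. norm (l k)) \<and> (\<forall>k. central_block r \<alpha> (a k))
     \<and> (AE x in haar. (\<lambda>k. l k * a k x) sums f x)"

definition block_space :: "real \<Rightarrow> real \<Rightarrow> ('p::prime_card padic \<Rightarrow> complex) set" where
  "block_space r \<alpha> = {f \<in> Lr_loc r. \<exists>l a. block_decomposition r \<alpha> f l a}"

definition block_norm :: "real \<Rightarrow> real \<Rightarrow> ('p::prime_card padic \<Rightarrow> complex) \<Rightarrow> real" where
  "block_norm r \<alpha> f = Inf {\<Sum>k. norm (l k) | l a. block_decomposition r \<alpha> f l a}"

definition dilation :: "'p::prime_card padic \<Rightarrow> ('p padic \<Rightarrow> complex) \<Rightarrow> 'p padic \<Rightarrow> complex" where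
  "dilation \<tau> f = (\<lambda>x. f (\<tau> * x))"

end

theory Submission
  imports Defs
begin

text \<open>The substitution \<open>y = \<tau> x\<close> multiplies integrals by \<open>\<bar>\<tau>\<bar>\<^sup>-\<^sup>1\<close>. As \<open>\<bar>\<tau>\<bar>\<close> lies in the value group
  \<open>p\<^bsup>\<int>\<^esup>\<close>, dilation turns a central block supported in a ball into \<open>\<bar>\<tau>\<bar>\<^bsup>-(1/r+\<alpha>)\<^esup>\<close> times a central block
  supported in another such ball. Decompositions are thereby transported term by term, which gives
  the estimate even with constant 1 instead of 2. The change of variables rests on the uniqueness of
  Haar measure, which is determined by its values on balls.\<close>

section \<open>Haar measure of balls\<close>

lemma real_CARD_prime_gt_1: "real CARD('p::prime_card) > 1"
  using prime_gt_1_nat[OF prime_card] by simp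

lemma normalized_haar_cball_translate:
  fixes M :: "'p::prime_card padic measure"
  assumes "normalized_haar M"
  shows "emeasure M (cball c s) = emeasure M (cball 0 s)"
proof -
  have "y \<in> (\<lambda>x. c + x) ` cball 0 s \<longleftrightarrow> y \<in> cball c s" for y
    by (auto simp: image_iff dist_padic_def padic_norm_minus_commute intro!: bexI[of _ "y - c"])
  then have "(\<lambda>x. c + x) ` cball 0 s = cball c s" by blast
  moreover have "cball 0 s \<in> sets (borel :: 'p padic measure)" by simp
  ultimately show ?thesis using assms unfolding normalized_haar_def by metis
qed

text \<open>The factor is the number of cosets, which does not depend on the measure; comparing
  with \<open>digit_measure\<close> therefore determines it without counting.\<close>

lemma cball_emeasure_ratio:
  fixes a b :: int
  assumes "a \<le> b"
  obtains k where "\<And>M :: 'p::prime_card padic measure. sets M = sets borel \<Longrightarrow>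
    (\<And>c. emeasure M (cball c (real CARD('p) powi a)) = emeasure M (cball 0 (real CARD('p) powi a))) \<Longrightarrow>
    emeasure M (cball 0 (real CARD('p) powi b)) = emeasure M (cball 0 (real CARD('p) powi a)) * k"
proof -
  let ?s = "real CARD('p) powi a" and ?R = "real CARD('p) powi b"
  \<comment> \<open>A set of balls rather than of centres, so each coset of the small ball inside
    the large one occurs once.\<close>
  define I where "I = (\<lambda>x. cball x ?s) ` cball (0 :: 'p padic) ?R"
  have sR: "?s \<le> ?R"
    using assms real_CARD_prime_gt_1[where 'p = 'p] by (intro power_int_increasing) auto
  \<comment> \<open>Every point of a ball is a centre of it, so each member can be recentred at one
    of countably many digit points; the index \<open>- a\<close> gives these the precision
    p^a.\<close>
  have "I \<subseteq> range (\<lambda>m. cball (padic_of_rat (digit_pt CARD('p) (- a) m)) ?s)"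
  proof
    fix B assume "B \<in> I"
    then obtain x where B: "B = cball x ?s" by (auto simp: I_def)
    obtain m where "dist x (padic_of_rat (digit_pt CARD('p) (- a) m)) \<le> ?s"
      using digit_pt_approx[of x "- a"] by auto
    from cball_padic_eq[OF this] show "B \<in> range (\<lambda>m. cball (padic_of_rat (digit_pt CARD('p) (- a) m)) ?s)"
      unfolding B by blast
  qed
  then have cnt: "countable I" by (rule countable_subset) auto
  have disj: "disjoint_family_on (\<lambda>B. B) I"
    unfolding disjoint_family_on_def
  proof (intro ballI impI)
    fix A B assume "A \<in> I" "B \<in> I" "A \<noteq> B"
    then obtain x y where xy: "A = cball x ?s" "B = cball y ?s" by (auto simp: I_def)
    have "A = B" if "z \<in> A \<inter> B" for z
    proof -
      have "dist x z \<le> ?s" "dist y z \<le> ?s" using that by (simp_all add: xy)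
      then show ?thesis unfolding xy by (metis cball_padic_eq)
    qed
    then show "A \<inter> B = {}" using \<open>A \<noteq> B\<close> by blast
  qed
  have 1: "cball 0 ?R \<subseteq> \<Union>I"
  proof
    fix x :: "'p padic" assume "x \<in> cball 0 ?R"
    then have "cball x ?s \<in> I" unfolding I_def by (rule imageI)
    moreover have "x \<in> cball x ?s" using real_CARD_prime_gt_1[where 'p = 'p] by simp
    ultimately show "x \<in> \<Union>I" by (rule UnionI)
  qed
  have "cball x ?s \<subseteq> cball 0 ?R" if "x \<in> cball 0 ?R" for x :: "'p padic"
  proof -
    have "cball x ?s \<subseteq> cball x ?R" using sR by (rule subset_cball)
    also have "\<dots> = cball 0 ?R"
      using that by (intro cball_padic_eq) (simp add: dist_commute)
    finally show ?thesis .
  qed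
  then have "\<Union>I \<subseteq> cball 0 ?R" unfolding I_def by (rule UN_least)
  then have un: "\<Union>I = cball 0 ?R" using 1 by (rule equalityI)
  \<comment> \<open>This \<open>k\<close> is the number of balls in \<open>I\<close> as an
    \<open>ennreal\<close>; it is fixed before any measure is chosen.\<close>
  show ?thesis
  proof (rule that[of "emeasure (count_space I) I"])
    fix M :: "'p padic measure" assume sets: "sets M = sets borel"
      and M: "emeasure M (cball c ?s) = emeasure M (cball 0 ?s)" for c
    have sets_I: "B \<in> sets M" if "B \<in> I" for B
      using that unfolding I_def sets by auto
    have "emeasure M (\<Union>I) = (\<integral>\<^sup>+B. emeasure M B \<partial>count_space I)"
      using emeasure_UN_countable[OF sets_I cnt disj] unfolding image_ident .
    also have "\<dots> = (\<integral>\<^sup>+B. emeasure M (cball 0 ?s) \<partial>count_space I)"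
    proof (rule nn_integral_cong)
      fix B assume "B \<in> space (count_space I)"
      then obtain x where B: "B = cball x ?s" by (auto simp: I_def)
      show "emeasure M B = emeasure M (cball 0 ?s)" unfolding B by (rule M)
    qed
    also have "\<dots> = emeasure M (cball 0 ?s) * emeasure (count_space I) I"
      by simp
    finally show "emeasure M (cball 0 ?R) = emeasure M (cball 0 ?s) * emeasure (count_space I) I"
      unfolding un .
  qed
qed

text \<open>This is uniqueness of Haar measure on balls: \<open>M\<close> and
  \<open>digit_measure\<close> both give the unit ball mass 1 and grow by the same factor between
  concentric balls, so they agree on all balls, and the value for \<open>digit_measure\<close> is
  known.\<close>

lemma normalized_haar_cball:
  fixes M :: "'p::prime_card padic measure"
  assumes M: "normalized_haar M"
  shows "emeasure M (cball c (real CARD('p) powi n)) = ennreal (real CARD('p) powi n)"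
proof -
  let ?N = "digit_measure :: 'p padic measure"
  let ?B = "\<lambda>n. cball (0 :: 'p padic) (real CARD('p) powi n)"
  have "{x :: 'p padic. padic_norm x \<le> 1} = ?B 0" by (auto simp: dist_padic_def)
  then have M0: "emeasure M (?B 0) = 1" using M by (simp add: normalized_haar_def)
  have N0: "emeasure ?N (?B 0) = 1" by (subst emeasure_digit_measure_cball) simp
  have sets: "sets M = sets borel" "sets ?N = sets borel"
    using M by (simp_all add: normalized_haar_def digit_measure_def)
  have ratio: "\<exists>k. emeasure M (?B b) = emeasure M (?B a) * k \<and> emeasure ?N (?B b) = emeasure ?N (?B a) * k"
    if ab: "a \<le> b" for a b
  proof (rule cball_emeasure_ratio[OF ab, where 'p = 'p])
    fix k assume k: "\<And>L :: 'p padic measure. sets L = sets borel \<Longrightarrow>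
        (\<And>c. emeasure L (cball c (real CARD('p) powi a)) = emeasure L (?B a)) \<Longrightarrow>
        emeasure L (?B b) = emeasure L (?B a) * k"
    have "emeasure M (?B b) = emeasure M (?B a) * k"
      by (rule k[OF sets(1) normalized_haar_cball_translate[OF M]])
    moreover have "emeasure ?N (?B b) = emeasure ?N (?B a) * k"
      by (rule k[OF sets(2)]) (simp only: emeasure_digit_measure_cball)
    ultimately show ?thesis by blast
  qed
  have "emeasure M (?B n) = emeasure ?N (?B n)"
  proof (cases "n \<ge> 0")
    case True
    then obtain k where "emeasure M (?B n) = 1 * k" "emeasure ?N (?B n) = 1 * k"
      using ratio[of 0 n] unfolding M0 N0 by blast
    then show ?thesis by metis
  next
    case False
    then obtain k where 1: "1 = emeasure M (?B n) * k" "1 = emeasure ?N (?B n) * k"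
      using ratio[of n 0] unfolding M0 N0 by auto
    \<comment> \<open>Both masses are multiplicative inverses of \<open>k\<close>, hence equal;
      associativity and commutativity replace a division in \<open>ennreal\<close>.\<close>
    have "emeasure M (?B n) = emeasure M (?B n) * (emeasure ?N (?B n) * k)" by (simp flip: 1(2))
    also have "\<dots> = emeasure ?N (?B n) * (emeasure M (?B n) * k)" by (simp only: ac_simps)
    also have "\<dots> = emeasure ?N (?B n)" by (simp flip: 1(1))
    finally show ?thesis .
  qed
  then show ?thesis
    unfolding normalized_haar_cball_translate[OF M, of c] emeasure_digit_measure_cball .
qed

section \<open>The chosen measure \<open>haar\<close> and its value on balls\<close>

lemma sets_haar [simp, measurable_cong]: "sets (haar :: 'p::prime_card padic measure) = sets borel"
  using normalized_haar_haar[where 'a = 'p] by (simp add: normalized_haar_def)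

lemma space_haar [simp]: "space haar = UNIV"
  using sets_eq_imp_space_eq[OF sets_haar] by simp

lemma padic_ball_eq_cball: "padic_ball n = cball (0 :: 'p::prime_card padic) (real CARD('p) powi n)"
  by (auto simp: padic_ball_def dist_padic_def)

lemma measure_padic_ball: "measure haar (padic_ball n :: 'p::prime_card padic set) = real CARD('p) powi n"
  by (simp add: padic_ball_eq_cball measure_def normalized_haar_cball[OF normalized_haar_haar])

section \<open>Dilation and Haar measure\<close>

lemma padic_norm_pos [simp]: "padic_norm (x :: 'p::prime_card padic) > 0 \<longleftrightarrow> x \<noteq> 0"
  by (simp add: order_less_le)

text \<open>A rational closer to x than the size of x has the same absolute value as x by the
  ultrametric inequality, and for nonzero rationals the value is a power of p by definition.\<close>

lemma padic_norm_value_group: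
  fixes x :: "'p::prime_card padic"
  assumes "x \<noteq> 0"
  obtains k where "padic_norm x = real CARD('p) powi k"
proof -
  have zero: "padic_of_rat 0 = (0 :: 'p padic)"
    by (simp add: padic_of_rat_def zero_padic_def)
  \<comment> \<open>Density only yields a weak inequality; halving makes the distance strictly
    smaller than the norm of x.\<close>
  obtain q where q: "dist x (padic_of_rat q) \<le> padic_norm x / 2"
    using padic_of_rat_dense[of "padic_norm x / 2" x] assms by auto
  let ?y = "padic_of_rat q :: 'p padic"
  have d: "padic_norm (x - ?y) < padic_norm x"
    using q padic_norm_pos[of x] assms unfolding dist_padic_def by linarith
  have "padic_norm x \<le> max (padic_norm (x - ?y)) (padic_norm ?y)"
    using padic_norm_ultrametric[of "x - ?y" ?y] by simp
  moreover have "padic_norm ?y \<le> max (padic_norm (x - ?y)) (padic_norm x)"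
    using padic_norm_ultrametric[of "?y - x" x] padic_norm_minus_commute[of x ?y] by simp
  ultimately have "padic_norm x = padic_norm ?y" using d by linarith
  also have "\<dots> = pabs CARD('p) q"
    using dist_padic_of_rat[of q 0, where 'p = 'p] by (simp add: zero dist_padic_def)
  finally have eq: "padic_norm x = pabs CARD('p) q" .
  then have "q \<noteq> 0" using assms by auto
  then show ?thesis using that eq by (simp add: pabs_def)
qed

section \<open>Multiplication by a scalar as a change of variables\<close>

lemma continuous_on_padic_mult: "continuous_on A (\<lambda>x :: 'p::prime_card padic. t * x)"
proof (cases "t = 0")
  case False
  have d: "dist (t * x) (t * y) = padic_norm t * dist x y" for x y
    by (simp add: dist_padic_def padic_norm_mult flip: right_diff_distrib)
  show ?thesis
    unfolding continuous_on_iff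
  proof (intro ballI allI impI)
    fix x and e :: real assume "x \<in> A" "e > 0"
    then show "\<exists>d>0. \<forall>x'\<in>A. dist x' x < d \<longrightarrow> dist (t * x') (t * x) < e"
      using False
      by (intro exI[of _ "e / padic_norm t"]) (auto simp: d pos_less_divide_eq mult.commute[of _ "padic_norm t"])
  qed
qed auto

lemma measurable_padic_mult [measurable]: "(\<lambda>x :: 'p::prime_card padic. t * x) \<in> measurable haar haar"
proof -
  have "(\<lambda>x :: 'p padic. t * x) \<in> borel_measurable borel"
    by (intro borel_measurable_continuous_onI continuous_on_padic_mult)
  then show ?thesis by (metis measurable_cong_sets sets_haar)
qed

text \<open>The preimage of a ball of radius p^n is a ball of radius p^(n-k), where p^k is the norm
  of \<open>t\<close>. Hence both measures agree on balls, which determine them.\<close>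

lemma distr_haar_mult:
  fixes t :: "'p::prime_card padic"
  assumes t: "t \<noteq> 0"
  shows "distr haar haar (\<lambda>x. t * x) = density haar (\<lambda>_. ennreal (1 / padic_norm t))"
    (is "?L = ?R")
proof (rule padic_measure_eqI)
  fix c :: "'p padic" and n
  obtain k where k: "padic_norm t = real CARD('p) powi k" using padic_norm_value_group[OF t] .
  have p1: "real CARD('p) > 1" by (rule real_CARD_prime_gt_1)
  have "dist (c / t) x = dist c (t * x) / padic_norm t" for x
  proof -
    have "c - t * x = t * (c / t - x)" using t by (simp add: right_diff_distrib)
    then have "dist c (t * x) = padic_norm t * dist (c / t) x" by (simp only: dist_padic_def padic_norm_mult)
    then show ?thesis using t by simp
  qed
  \<comment> \<open>Since the norm of \<open>t\<close> is a power of p, the rescaled radius is again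
    one for which the mass of the ball is known.\<close>
  moreover have "u / padic_norm t \<le> real CARD('p) powi (n - k) \<longleftrightarrow> u \<le> real CARD('p) powi n" for u
    using p1 by (simp add: k power_int_diff pos_divide_le_eq)
  ultimately have "(\<lambda>x. t * x) -` cball c (real CARD('p) powi n) = cball (c / t) (real CARD('p) powi (n - k))"
    by auto
  then have "emeasure ?L (cball c (real CARD('p) powi n)) = ennreal (real CARD('p) powi (n - k))"
    by (simp add: emeasure_distr normalized_haar_cball[OF normalized_haar_haar])
  also have "\<dots> = ennreal (1 / padic_norm t) * ennreal (real CARD('p) powi n)"
    using p1 by (simp add: k power_int_diff flip: ennreal_mult)
  also have "\<dots> = emeasure ?R (cball c (real CARD('p) powi n))"
    by (simp add: emeasure_density_const normalized_haar_cball[OF normalized_haar_haar])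
  finally show "emeasure ?L (cball c (real CARD('p) powi n)) = emeasure ?R (cball c (real CARD('p) powi n))" .
  show "emeasure ?L (cball c (real CARD('p) powi n)) \<noteq> \<infinity>"
    unfolding \<open>emeasure ?L (cball c (real CARD('p) powi n)) = ennreal (real CARD('p) powi (n - k))\<close> by simp
qed simp_all

text \<open>The image of Haar measure has a density with respect to Haar measure, so preimages of
  null sets are null.\<close>

lemma AE_haar_mult:
  fixes t :: "'p::prime_card padic"
  assumes "t \<noteq> 0" "AE x in haar. P x"
  shows "AE x in haar. P (t * x)"
proof (rule AE_distrD[OF measurable_padic_mult])
  show "AE x in distr haar haar (\<lambda>x. t * x). P x"
    unfolding distr_haar_mult[OF assms(1)] using assms(2) by (subst AE_density) auto
qed

lemma integrable_haar_mult:
  fixes t :: "'p::prime_card padic" and f :: "'p padic \<Rightarrow> real"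
  assumes "t \<noteq> 0" "integrable haar f"
  shows "integrable haar (\<lambda>x. f (t * x))"
    and "(\<integral>x. f (t * x) \<partial>haar) = (\<integral>x. f x \<partial>haar) / padic_norm t"
proof -
  have [measurable]: "f \<in> borel_measurable haar" using assms(2) by auto
  have "integrable (distr haar haar (\<lambda>x. t * x)) f"
    unfolding distr_haar_mult[OF assms(1)] using assms(2) by (subst integrable_density) auto
  then show "integrable haar (\<lambda>x. f (t * x))" by (subst (asm) integrable_distr_eq) auto
  have "(\<integral>x. f (t * x) \<partial>haar) = integral\<^sup>L (distr haar haar (\<lambda>x. t * x)) f"
    by (subst integral_distr) auto
  also have "\<dots> = (\<integral>x. f x \<partial>haar) / padic_norm t"
    unfolding distr_haar_mult[OF assms(1)] by (subst integral_density) auto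
  finally show "(\<integral>x. f (t * x) \<partial>haar) = (\<integral>x. f x \<partial>haar) / padic_norm t" .
qed

section \<open>Dilation on block spaces\<close>

lemma dilation_Lr_loc:
  fixes t :: "'p::prime_card padic"
  assumes t: "t \<noteq> 0" and f: "f \<in> Lr_loc r"
  shows "dilation t f \<in> Lr_loc r"
proof -
  have [measurable]: "f \<in> borel_measurable haar" using f by (simp add: Lr_loc_def)
  have "set_integrable haar K (\<lambda>x. norm (f (t * x)) powr r)" if K: "compact K" for K
  proof -
    have "compact ((\<lambda>x. t * x) ` K)"
      by (intro compact_continuous_image continuous_on_padic_mult K)
    then have "integrable haar (\<lambda>x. indicator ((\<lambda>x. t * x) ` K) x *\<^sub>R norm (f x) powr r)"
      using f by (simp add: Lr_loc_def set_integrable_def)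
    \<comment> \<open>As \<open>t\<close> is invertible, t * x lies in the image of \<open>K\<close>
      exactly when x lies in \<open>K\<close>, so the indicator pulls back to that of
      \<open>K\<close>.\<close>
    from integrable_haar_mult(1)[OF t this]
    show ?thesis using t by (simp add: set_integrable_def indicator_def image_iff)
  qed
  then show ?thesis by (simp add: Lr_loc_def dilation_def)
qed

text \<open>The exponent has two sources: 1/r compensates the Jacobian after taking the r-th root,
  and \<alpha> compensates the change of the supporting ball from radius p^n to p^(n-k).\<close>

lemma central_block_dilation:
  fixes t :: "'p::prime_card padic"
  assumes r: "r > 0" and t: "t \<noteq> 0" and a: "central_block r \<alpha> a"
  shows "central_block r \<alpha> (\<lambda>x. of_real (padic_norm t powr (1 / r + \<alpha>)) * dilation t a x)"
    (is "central_block r \<alpha> ?b")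
proof -
  define C where "C = padic_norm t powr (1 / r + \<alpha>)"
  have tp: "padic_norm t > 0" using t by simp
  then have C: "C > 0" by (simp add: C_def)
  obtain k where k: "padic_norm t = real CARD('p) powi k" using padic_norm_value_group[OF t] .
  have p1: "real CARD('p) > 1" by (rule real_CARD_prime_gt_1)
  obtain n where supp: "closure {x. a x \<noteq> 0} \<subseteq> padic_ball n"
    and norm: "Lr_norm r a \<le> (real CARD('p) powi n) powr (- \<alpha>)"
    using a by (auto simp: central_block_def measure_padic_ball)
  have [measurable]: "a \<in> borel_measurable haar" and int: "integrable haar (\<lambda>x. norm (a x) powr r)"
    using a by (auto simp: central_block_def Lr_def)
  have norm_b: "norm (?b x) powr r = C powr r * norm (a (t * x)) powr r" for x
    using C by (simp add: dilation_def norm_mult powr_mult flip: C_def)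
  have "?b \<in> Lr r"
    unfolding Lr_def mem_Collect_eq norm_b
    using integrable_haar_mult(1)[OF t int] by (simp add: dilation_def)
  moreover have "closure {x. ?b x \<noteq> 0} \<subseteq> padic_ball (n - k)"
  \<comment> \<open>Balls are closed, so it suffices to locate the points where the function is
    nonzero.\<close>
  proof (rule closure_minimal)
    show "closed (padic_ball (n - k) :: 'p padic set)" by (simp add: padic_ball_eq_cball)
    have a0: "a x \<noteq> 0 \<Longrightarrow> padic_norm x \<le> real CARD('p) powi n" for x
      using supp closure_subset[of "{x. a x \<noteq> 0}"] by (auto simp: padic_ball_def)
    have "padic_norm x \<le> real CARD('p) powi (n - k)" if "a (t * x) \<noteq> 0" for x
      using a0[OF that] p1 by (simp add: padic_norm_mult k power_int_diff pos_le_divide_eq mult.commute)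
    then show "{x. ?b x \<noteq> 0} \<subseteq> padic_ball (n - k)"
      by (auto simp: padic_ball_def dilation_def)
  qed
  moreover have "Lr_norm r ?b \<le> (real CARD('p) powi (n - k)) powr (- \<alpha>)"
  proof -
    have "Lr_norm r ?b = (C powr r * ((\<integral>x. norm (a x) powr r \<partial>haar) / padic_norm t)) powr (1 / r)"
      unfolding Lr_norm_def norm_b by (simp add: integrable_haar_mult(2)[OF t int])
    also have "\<dots> = C * (Lr_norm r a / padic_norm t powr (1 / r))"
      using C tp r unfolding Lr_norm_def
      by (subst powr_mult) (simp_all add: powr_divide powr_powr)
    \<comment> \<open>The Jacobian factor cancels the 1/r part of \<open>C\<close>.\<close>
    also have "\<dots> = padic_norm t powr \<alpha> * Lr_norm r a"
      using tp by (simp add: C_def powr_add)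
    also have "\<dots> \<le> padic_norm t powr \<alpha> * (real CARD('p) powi n) powr (- \<alpha>)"
      by (intro mult_left_mono norm) simp
    \<comment> \<open>The remaining factor p^(k \<alpha>) turns the bound for the old ball into the
      one for the new ball.\<close>
    also have "\<dots> = (real CARD('p) powi (n - k)) powr (- \<alpha>)"
      using p1 by (simp add: k power_int_diff powr_divide powr_minus_divide)
    finally show ?thesis .
  qed
  ultimately show ?thesis unfolding central_block_def measure_padic_ball by blast
qed

text \<open>The factor \<open>C\<close> that makes the dilated functions blocks is divided out of
  the coefficients, so each term is just the old term evaluated at t * x.\<close>

lemma block_decomposition_dilation:
  fixes t :: "'p::prime_card padic"
  assumes r: "r > 0" and t: "t \<noteq> 0" and d: "block_decomposition r \<alpha> f l a"
  defines "C \<equiv> padic_norm t powr (1 / r + \<alpha>)"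
  shows "block_decomposition r \<alpha> (dilation t f) (\<lambda>k. l k / of_real C)
    (\<lambda>k x. of_real C * dilation t (a k) x)"
  unfolding block_decomposition_def
proof (intro conjI allI)
  have C: "C > 0" using t by (simp add: C_def)
  show "summable (\<lambda>k. norm (l k / of_real C))"
    using d by (auto simp: block_decomposition_def norm_divide intro!: summable_divide)
  show "central_block r \<alpha> (\<lambda>x. of_real C * dilation t (a k) x)" for k
    using d unfolding C_def by (intro central_block_dilation r t) (simp add: block_decomposition_def)
  have "AE x in haar. (\<lambda>k. l k * a k x) sums f x" using d by (simp add: block_decomposition_def)
  from AE_haar_mult[OF t this]
  show "AE x in haar. (\<lambda>k. l k / of_real C * (of_real C * dilation t (a k) x)) sums dilation t f x"
    using C by (simp add: dilation_def)
qed

section \<open>The block norm as an infimum\<close>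

lemma block_norm_le:
  assumes "block_decomposition r \<alpha> f l a"
  shows "block_norm r \<alpha> f \<le> (\<Sum>k. norm (l k))"
  unfolding block_norm_def
proof (rule cInf_lower)
  show "bdd_below {\<Sum>k. norm (l k) | l a. block_decomposition r \<alpha> f l a}"
    by (rule bdd_belowI[of _ 0]) (auto simp: block_decomposition_def intro!: suminf_nonneg)
qed (use assms in auto)

text \<open>Membership in the space makes the set of sums nonempty, without which \<open>Inf\<close>
  on the reals gives no lower bound.\<close>

lemma block_norm_greatest:
  assumes "f \<in> block_space r \<alpha>"
    and "\<And>l a. block_decomposition r \<alpha> f l a \<Longrightarrow> c \<le> (\<Sum>k. norm (l k))"
  shows "c \<le> block_norm r \<alpha> f"
  unfolding block_norm_def using assms by (intro cInf_greatest) (auto simp: block_space_def)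

lemma block_norm_nonneg: "f \<in> block_space r \<alpha> \<Longrightarrow> block_norm r \<alpha> f \<ge> 0"
  by (rule block_norm_greatest) (auto simp: block_decomposition_def intro!: suminf_nonneg)

lemma dilation_block_space:
  assumes "r > 0" "t \<noteq> 0" "f \<in> block_space r \<alpha>"
  shows "dilation t f \<in> block_space r \<alpha>"
  using assms dilation_Lr_loc block_decomposition_dilation unfolding block_space_def by blast

lemma block_norm_dilation_le:
  fixes t :: "'p::prime_card padic"
  assumes r: "r > 0" and t: "t \<noteq> 0" and f: "f \<in> block_space r \<alpha>"
  shows "block_norm r \<alpha> (dilation t f) \<le> padic_norm t powr (- (1 / r + \<alpha>)) * block_norm r \<alpha> f"
proof -
  define C where "C = padic_norm t powr (1 / r + \<alpha>)"
  have C: "C > 0" using t by (simp add: C_def)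
  \<comment> \<open>With \<open>C\<close> on the left, the claim becomes a lower bound for every
    coefficient sum of \<open>f\<close>, and the infimum can be taken over decompositions of
    \<open>f\<close> alone.\<close>
  have "C * block_norm r \<alpha> (dilation t f) \<le> block_norm r \<alpha> f"
  proof (rule block_norm_greatest[OF f])
    fix l a assume d: "block_decomposition r \<alpha> f l a"
    have "block_norm r \<alpha> (dilation t f) \<le> (\<Sum>k. norm (l k / of_real C))"
      unfolding C_def by (rule block_norm_le[OF block_decomposition_dilation[OF r t d]])
    also have "\<dots> = (\<Sum>k. norm (l k)) / C"
      using C d by (simp add: norm_divide suminf_divide block_decomposition_def)
    finally show "C * block_norm r \<alpha> (dilation t f) \<le> (\<Sum>k. norm (l k))"
      using C by (simp add: field_simps)
  qed
  then show ?thesis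
    using C unfolding powr_minus C_def[symmetric] by (simp add: field_simps)
qed

theorem theorem3p1:
  fixes \<tau> :: "'p::prime_card padic" and r \<alpha> :: real
  assumes "1 < r" and "0 < \<alpha>" and "\<tau> \<noteq> 0"
  shows "\<forall>f \<in> block_space r \<alpha>. dilation \<tau> f \<in> block_space r \<alpha> \<and>
    block_norm r \<alpha> (dilation \<tau> f) \<le> 2 * padic_norm \<tau> powr (- (1 / r + \<alpha>)) * block_norm r \<alpha> f"
proof (intro ballI conjI)
  fix f :: "'p padic \<Rightarrow> complex" assume f: "f \<in> block_space r \<alpha>"
  have r: "r > 0" using assms by simp
  show "dilation \<tau> f \<in> block_space r \<alpha>" by (rule dilation_block_space[OF r assms(3) f])
  \<comment> \<open>Nonnegativity allows the constant 1 to be enlarged to 2.\<close>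
  have "0 \<le> padic_norm \<tau> powr (- (1 / r + \<alpha>)) * block_norm r \<alpha> f"
    using block_norm_nonneg[OF f] by simp
  then show "block_norm r \<alpha> (dilation \<tau> f) \<le> 2 * padic_norm \<tau> powr (- (1 / r + \<alpha>)) * block_norm r \<alpha> f"
    using block_norm_dilation_le[OF r assms(3) f] by linarith
qed

end
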